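(* Let $\mathcal A$ be a faithful Banach algebra such that $\{ab : a,b\in\mathcal A\}$ is linearly dense in $\mathcal A$. Let $(\mathcal B,\mathcal B_* )$ be a dual Banach algebra, and let $\iota:\mathcal A\to\mathcal B$ be an isometric homomorphism such that $\iota(\mathcal A)$ is an essential ideal in $\mathcal B$. Suppose that the induced map $\mathcal B\to M(\mathcal A)$ is injective. Then there is a weak$^*$-topology on $M(\mathcal A)$ making $M(\mathcal A)$ a dual Banach algebra.
   Context: A Banach algebra $\mathcal A$ is faithful (as a bimodule over itself) if $x\in\mathcal A$ and $axb=0$ for all $a,b\in\mathcal A$ imply $x=0$. A multiplier of $\mathcal A$ is a pair $(L,R)$ of maps $\mathcal A\to\mathcal A$ with $aL(b)=R(a)b$ for all $a,b\in\mathcal A$; when $\mathcal A$ is faithful, $L,R$ are automatically linear and bounded. $M(\mathcal A)$ is the set of multipliers, a Banach algebra with norm $\|(L,R)\|=\max(\|L\|,\|R\|)$ and product $(L,R)(L',R')=(LL',R'R)$. A dual Banach algebra is a Banach algebra $\mathcal B$ that is (isometrically) the dual $(\mathcal B_* )^*$ of a Banach space $\mathcal B_*$ such that multiplication is separately weak$^*$-continuous. "A weak$^*$-topology on $M(\mathcal A)$" means the weak$^*$-topology coming from an isometric identification of $M(\mathcal A)$ with the dual of a Banach space. An ideal $I$ of an algebra $\mathcal B$ is essential if every ideal $J$ of $\mathcal B$ with $I\cap J=\{0\}$ is $\{0\}$. Since $\iota(\mathcal A)$ is an ideal, each $b\in\mathcal B$ gives $(L_b,R_b)\in M(\mathcal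 A)$ with $\iota(L_b(a))=b\,\iota(a)$, $\iota(R_b(a))=\iota(a)\,b$ for $a\in\mathcal A$; the induced map $\mathcal B\to M(\mathcal A)$ is $b\mapsto(L_b,R_b)$. *)

theory Defs
  imports
    "HOL-Analysis.Analysis"
    "HOL-Library.Function_Algebras"
    "HOL-Library.FuncSet"
begin

section \<open>Complex Banach spaces and Banach algebras as types\<close>

text \<open>
  The library classes are over the reals. The complex scalars are added on top of them; the
  topology, norm and completeness are those of the library. Algebras need not have a unit.
\<close>

class complex_banach_space = banach +
  fixes scaleC :: "complex \<Rightarrow> 'a \<Rightarrow> 'a"
  assumes scaleC_add_right: "scaleC c (x + y) = scaleC c x + scaleC c y"
    and scaleC_add_left: "scaleC (c + d) x = scaleC c x + scaleC d x"
    and scaleC_scaleC: "scaleC c (scaleC d x) = scaleC (c * d) x"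
    and scaleC_of_real: "scaleC (complex_of_real r) x = scaleR r x"
    and norm_scaleC: "norm (scaleC c x) = cmod c * norm x"

class complex_banach_algebra = complex_banach_space + real_normed_algebra +
  assumes mult_scaleC_left: "scaleC c x * y = scaleC c (x * y)"
    and mult_scaleC_right: "x * scaleC c y = scaleC c (x * y)"

lemma vector_space_scaleC:
  "vector_space (scaleC :: complex \<Rightarrow> 'a::complex_banach_space \<Rightarrow> 'a)"
proof
  show "scaleC 1 x = x" for x :: 'a
    using scaleC_of_real[of 1 x] by simp
qed (simp_all add: scaleC_add_right scaleC_add_left scaleC_scaleC)

instantiation complex :: complex_banach_algebra
begin
definition scaleC_complex :: "complex \<Rightarrow> complex \<Rightarrow> complex" where
  "scaleC_complex c x = c * x"
instance
  by standard (simp_all add: scaleC_complex_def algebra_simps scaleR_conv_of_real norm_mult)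
end


section \<open>Complex Banach spaces and Banach algebras on a carrier\<close>

text \<open>
  The algebra of multipliers, and a predual whose existence is asserted, are not types. They are
  given as a linear subspace \<open>X\<close> of some complex vector space, with a norm \<open>nrm\<close> and a product
  \<open>mul\<close> that matter on \<open>X\<close> only. Asserting a predual on a subspace of functions \<open>'v \<Rightarrow> complex\<close> is
  no restriction: every predual of a subspace of \<open>'v\<close> embeds isometrically in its dual, whose
  elements are such functions.
\<close>

locale complex_normed_on = vector_space sc
  for sc :: "complex \<Rightarrow> 'v::ab_group_add \<Rightarrow> 'v" +
  fixes X :: "'v set" and nrm :: "'v \<Rightarrow> real"
  assumes subspace_carrier: "subspace X"
    and nrm_eq_0: "x \<in> X \<Longrightarrow> nrm x = 0 \<longleftrightarrow> x = 0"
    and nrm_triangle: "x \<in> X \<Longrightarrow> y \<in> X \<Longrightarrow> nrm (x + y) \<le> nrm x + nrm y"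
    and nrm_sc: "x \<in> X \<Longrightarrow> nrm (sc c x) = cmod c * nrm x"
begin

text \<open>Functionals on \<open>X\<close> are identified with extensional functions, so that two of them are equal
  iff they agree on \<open>X\<close>.\<close>

definition dual :: "('v \<Rightarrow> complex) set" where
  "dual = {f \<in> extensional X.
     (\<forall>x\<in>X. \<forall>y\<in>X. f (x + y) = f x + f y) \<and>
     (\<forall>c. \<forall>x\<in>X. f (sc c x) = c * f x) \<and>
     (\<exists>K. \<forall>x\<in>X. cmod (f x) \<le> K * nrm x)}"

definition dual_norm :: "('v \<Rightarrow> complex) \<Rightarrow> real" where
  "dual_norm f = (SUP x\<in>{x \<in> X. nrm x \<le> 1}. cmod (f x))"

end

locale complex_banach_on = complex_normed_on sc X nrm
  for sc :: "complex \<Rightarrow> 'v::ab_group_add \<Rightarrow> 'v" and X nrm +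
  assumes complete:
    "(\<And>n::nat. \<sigma> n \<in> X) \<Longrightarrow> (\<And>e. e > 0 \<Longrightarrow> \<exists>k. \<forall>m\<ge>k. \<forall>n\<ge>k. nrm (\<sigma> m - \<sigma> n) < e)
      \<Longrightarrow> \<exists>x\<in>X. (\<lambda>n. nrm (\<sigma> n - x)) \<longlonglongrightarrow> 0"

locale complex_banach_algebra_on = complex_banach_on sc X nrm
  for sc :: "complex \<Rightarrow> 'v::ab_group_add \<Rightarrow> 'v" and X nrm +
  fixes mul :: "'v \<Rightarrow> 'v \<Rightarrow> 'v"
  assumes mul_closed: "x \<in> X \<Longrightarrow> y \<in> X \<Longrightarrow> mul x y \<in> X"
    and mul_assoc: "x \<in> X \<Longrightarrow> y \<in> X \<Longrightarrow> z \<in> X \<Longrightarrow> mul (mul x y) z = mul x (mul y z)"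
    and mul_add_left: "x \<in> X \<Longrightarrow> y \<in> X \<Longrightarrow> z \<in> X \<Longrightarrow> mul (x + y) z = mul x z + mul y z"
    and mul_add_right: "x \<in> X \<Longrightarrow> y \<in> X \<Longrightarrow> z \<in> X \<Longrightarrow> mul x (y + z) = mul x y + mul x z"
    and mul_sc_left: "x \<in> X \<Longrightarrow> y \<in> X \<Longrightarrow> mul (sc c x) y = sc c (mul x y)"
    and mul_sc_right: "x \<in> X \<Longrightarrow> y \<in> X \<Longrightarrow> mul x (sc c y) = sc c (mul x y)"
    and nrm_mul: "x \<in> X \<Longrightarrow> y \<in> X \<Longrightarrow> nrm (mul x y) \<le> nrm x * nrm y"

lemma complex_banach_on_UNIV:
  "complex_banach_on scaleC (UNIV :: 'a::complex_banach_space set) norm"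
proof -
  interpret vector_space "scaleC :: complex \<Rightarrow> 'a \<Rightarrow> 'a"
    by (rule vector_space_scaleC)
  show ?thesis
  proof
    fix \<sigma> :: "nat \<Rightarrow> 'a"
    assume "\<And>e. e > 0 \<Longrightarrow> \<exists>k. \<forall>m\<ge>k. \<forall>n\<ge>k. norm (\<sigma> m - \<sigma> n) < e"
    then have "Cauchy \<sigma>"
      by (simp add: Cauchy_def dist_norm)
    then obtain x where "\<sigma> \<longlonglongrightarrow> x"
      by (meson Cauchy_convergent convergent_def)
    then show "\<exists>x\<in>UNIV. (\<lambda>n. norm (\<sigma> n - x)) \<longlonglongrightarrow> 0"
      by (auto simp: LIM_zero_iff tendsto_norm_zero_iff)
  qed (simp_all add: norm_scaleC norm_triangle_ineq)
qed

lemma complex_banach_algebra_on_UNIV: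
  "complex_banach_algebra_on scaleC (UNIV :: 'a::complex_banach_algebra set) norm (*)"
  by (intro complex_banach_algebra_on.intro complex_banach_on_UNIV
        complex_banach_algebra_on_axioms.intro)
     (simp_all add: algebra_simps mult_scaleC_left mult_scaleC_right norm_mult_ineq)


section \<open>Dual Banach algebras\<close>

text \<open>
  \<open>weak_star_topology X E \<Phi>\<close> is the coarsest topology on \<open>X\<close> for which all \<open>\<lambda>x. \<Phi> x e\<close> with
  \<open>e \<in> E\<close> are continuous. Here \<open>\<Phi>\<close> identifies \<open>X\<close> with the dual of \<open>E\<close>, so each \<open>\<Phi> x\<close> is
  extensional on \<open>E\<close>, as the points of the product topology are.
\<close>

definition weak_star_topology ::
    "'v set \<Rightarrow> 'e set \<Rightarrow> ('v \<Rightarrow> 'e \<Rightarrow> complex) \<Rightarrow> 'v topology" where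
  "weak_star_topology X E \<Phi> = pullback_topology X \<Phi> (product_topology (\<lambda>_. euclidean) E)"

locale dual_banach_algebra =
  complex_banach_algebra_on sc X nrm mul +
  predual: complex_banach_on scE E nrmE
  for sc :: "complex \<Rightarrow> 'v::ab_group_add \<Rightarrow> 'v" and X nrm mul
    and scE :: "complex \<Rightarrow> 'e::ab_group_add \<Rightarrow> 'e" and E nrmE +
  fixes \<Phi> :: "'v \<Rightarrow> 'e \<Rightarrow> complex"
  assumes bij_dual: "bij_betw \<Phi> X predual.dual"
    and add_dual: "x \<in> X \<Longrightarrow> y \<in> X \<Longrightarrow> e \<in> E \<Longrightarrow> \<Phi> (x + y) e = \<Phi> x e + \<Phi> y e"
    and sc_dual: "x \<in> X \<Longrightarrow> e \<in> E \<Longrightarrow> \<Phi> (sc c x) e = c * \<Phi> x e"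
    and isometric_dual: "x \<in> X \<Longrightarrow> predual.dual_norm (\<Phi> x) = nrm x"
    and weak_star_left: "x \<in> X \<Longrightarrow>
      continuous_map (weak_star_topology X E \<Phi>) (weak_star_topology X E \<Phi>) (\<lambda>y. mul x y)"
    and weak_star_right: "x \<in> X \<Longrightarrow>
      continuous_map (weak_star_topology X E \<Phi>) (weak_star_topology X E \<Phi>) (\<lambda>y. mul y x)"


section \<open>Ideals and homomorphisms\<close>

definition algebra_ideal :: "'b::complex_banach_algebra set \<Rightarrow> bool" where
  "algebra_ideal I \<longleftrightarrow>
     module.subspace scaleC I \<and> (\<forall>b. \<forall>x\<in>I. b * x \<in> I \<and> x * b \<in> I)"

definition essential_ideal :: "'b::complex_banach_algebra set \<Rightarrow> bool" where
  "essential_ideal I \<longleftrightarrow>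
     algebra_ideal I \<and> (\<forall>J. algebra_ideal J \<longrightarrow> I \<inter> J = {0} \<longrightarrow> J = {0})"

definition isometric_hom :: "('a::complex_banach_algebra \<Rightarrow> 'b::complex_banach_algebra) \<Rightarrow> bool"
  where
  "isometric_hom \<iota> \<longleftrightarrow>
     (\<forall>x y. \<iota> (x + y) = \<iota> x + \<iota> y) \<and> (\<forall>c x. \<iota> (scaleC c x) = scaleC c (\<iota> x)) \<and>
     (\<forall>x y. \<iota> (x * y) = \<iota> x * \<iota> y) \<and> (\<forall>x. norm (\<iota> x) = norm x)"


section \<open>Multipliers\<close>

definition faithful_algebra :: "'a::complex_banach_algebra itself \<Rightarrow> bool" where
  "faithful_algebra _ \<longleftrightarrow> (\<forall>x::'a. (\<forall>a b. a * x * b = 0) \<longrightarrow> x = 0)"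

type_synonym 'a map_pair = "('a \<Rightarrow> 'a) \<times> ('a \<Rightarrow> 'a)"

definition multipliers :: "'a::complex_banach_algebra map_pair set" where
  "multipliers = {(L, R). \<forall>a b. a * L b = R a * b}"

text \<open>
  Addition of pairs of maps is the componentwise, pointwise one of the library. The operator norm
  \<^const>\<open>onorm\<close> is meaningful for bounded linear maps only, which the components of a multiplier
  of a faithful algebra are.
\<close>

definition mult_scale ::
    "complex \<Rightarrow> 'a::complex_banach_algebra map_pair \<Rightarrow> 'a map_pair" where
  "mult_scale c = (\<lambda>(L, R). (\<lambda>a. scaleC c (L a), \<lambda>a. scaleC c (R a)))"

definition mult_norm :: "'a::complex_banach_algebra map_pair \<Rightarrow> real" where
  "mult_norm = (\<lambda>(L, R). max (onorm L) (onorm R))"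

definition mult_times :: "'a map_pair \<Rightarrow> 'a map_pair \<Rightarrow> 'a map_pair" where
  "mult_times = (\<lambda>(L, R) (L', R'). (L \<circ> L', R' \<circ> R))"

text \<open>
  When \<open>\<iota>\<close> is injective and its range is an ideal, \<open>inv \<iota>\<close> picks the unique
  \<open>L\<^sub>b a\<close> with \<open>\<iota> (L\<^sub>b a) = b * \<iota> a\<close>, and likewise \<open>R\<^sub>b a\<close>.
\<close>

definition induced_multiplier ::
    "('a::complex_banach_algebra \<Rightarrow> 'b::complex_banach_algebra) \<Rightarrow> 'b \<Rightarrow> 'a map_pair" where
  "induced_multiplier \<iota> b = (\<lambda>a. inv \<iota> (b * \<iota> a), \<lambda>a. inv \<iota> (\<iota> a * b))"

lemma induced_multiplier:
  assumes hom: "isometric_hom \<iota>" and ideal: "algebra_ideal (range \<iota>)"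
  shows "induced_multiplier \<iota> b \<in> multipliers"
    and "\<iota> (fst (induced_multiplier \<iota> b) a) = b * \<iota> a"
    and "\<iota> (snd (induced_multiplier \<iota> b) a) = \<iota> a * b"
proof -
  have L: "\<iota> (inv \<iota> (b * \<iota> a)) = b * \<iota> a" and R: "\<iota> (inv \<iota> (\<iota> a * b)) = \<iota> a * b" for a
    using ideal by (auto simp: algebra_ideal_def f_inv_into_f)
  show "\<iota> (fst (induced_multiplier \<iota> b) a) = b * \<iota> a"
    "\<iota> (snd (induced_multiplier \<iota> b) a) = \<iota> a * b"
    by (simp_all add: induced_multiplier_def L R)
  have inj: "x = y" if "\<iota> x = \<iota> y" for x y
  proof -
    have "\<iota> (x - y) + \<iota> y = \<iota> x"
      using hom by (metis isometric_hom_def diff_add_cancel)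
    then have "norm (x - y) = 0"
      using hom that by (metis isometric_hom_def add_cancel_left_left norm_zero)
    then show ?thesis by simp
  qed
  have "a * inv \<iota> (b * \<iota> a') = inv \<iota> (\<iota> a * b) * a'" for a a'
    by (rule inj) (use hom in \<open>simp add: isometric_hom_def L R mult.assoc\<close>)
  then show "induced_multiplier \<iota> b \<in> multipliers"
    by (simp add: multipliers_def induced_multiplier_def)
qed

end

theory Submission
  imports Defs
begin

text \<open>
  The predual is the norm closure \<open>E\<close> in \<open>M(A)\<^sup>*\<close> of the span of the functionals
  \<open>(L, R) \<mapsto> \<langle>\<iota> (L a), p\<rangle>\<close> and \<open>(L, R) \<mapsto> \<langle>\<iota> (R a), p\<rangle>\<close>. A bounded functional on \<open>E\<close> gives bounded
  \<open>S, T : A \<rightarrow> B\<close> with \<open>\<iota> c * S a = T c * \<iota> a\<close>. As the induced map is injective, \<open>\<iota> A\<close> has no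
  annihilator in \<open>B\<close>, so \<open>S (a * b) = S a * \<iota> b\<close> lies in the ideal \<open>\<iota> A\<close>; products being linearly
  dense, \<open>S\<close> and likewise \<open>T\<close> take values in \<open>\<iota> A\<close>, that is, they form a multiplier.

  For the weak* continuity of \<open>(L', R') \<mapsto> (L \<circ> L', R' \<circ> R)\<close> the delicate functional is
  \<open>\<langle>\<iota> (L (L' a)), p\<rangle>\<close>. If \<open>p = q \<cdot> \<iota> c\<close>, then \<open>c * L (L' a) = R c * L' a\<close> turns it into
  \<open>\<langle>\<iota> (L' a), q \<cdot> \<iota> (R c)\<rangle>\<close>, which is in \<open>E\<close>; by Hahn-Banach and the absence of annihilators such
  \<open>p\<close> span a dense subspace of the predual of \<open>B\<close>.
\<close>

section \<open>The Hahn-Banach theorem\<close>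

text \<open>The construction follows a familiar picture. Bounded complex-linear maps from
  \<open>'a\<close> to \<open>'b\<close> form the dual of the projective tensor product of
  \<open>'a\<close> with \<open>'p\<close>, so pairs \<open>(S, T)\<close> of such maps form the
  dual of an l1-sum of two such products. Composition with \<iota> embeds the multipliers
  isometrically among these pairs, and the point is that they fill the weak* closed subspace given
  by \<open>\<iota> c * S a = T c * \<iota> a\<close>. A predual is then a quotient of the l1-sum;
  realising it as a norm closure inside the dual of the multiplier algebra avoids building tensor
  products. Both families of functionals enter because the norm is the maximum of two operator
  norms, and because the relation between \<open>S\<close> and \<open>T\<close> comes from
  functionals that belong to both families at once. Multipliers are by definition arbitrary maps.
  Linearity comes from cancellation in a faithful algebra and boundedness from the closed graph
  theorem.\<close>

definition sublinear :: "('a::real_vector \<Rightarrow> real) \<Rightarrow> bool" where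
  "sublinear q \<longleftrightarrow>
     (\<forall>x y. q (x + y) \<le> q x + q y) \<and> (\<forall>r\<ge>0. \<forall>x. q (r *\<^sub>R x) = r * q x)"

lemma sublinear_add: "sublinear q \<Longrightarrow> q (x + y) \<le> q x + q y"
  and sublinear_scaleR: "sublinear q \<Longrightarrow> r \<ge> 0 \<Longrightarrow> q (r *\<^sub>R x) = r * q x"
  and sublinear_0: "sublinear q \<Longrightarrow> q 0 = 0"
proof -
  show "sublinear q \<Longrightarrow> q 0 = 0"
    unfolding sublinear_def using scaleR_zero_left[of 0] by (metis order_refl mult_zero_left)
qed (auto simp: sublinear_def)

lemma sublinear_minus: "sublinear q \<Longrightarrow> - q (- x) \<le> q x"
  using sublinear_add[of q x "- x"] sublinear_0[of q] by simp

text \<open>The inequality for \<open>inverse r\<close> at the point \<open>r *\<^sub>R x\<close> is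
  the reverse inequality for \<open>r\<close>, so one direction of homogeneity suffices.\<close>

lemma sublinearI:
  assumes "\<And>x y. q (x + y) \<le> q x + q y"
    and le: "\<And>r x. r > 0 \<Longrightarrow> q (r *\<^sub>R x) \<le> r * q x" and "q 0 = 0"
  shows "sublinear q"
proof -
  have "q (r *\<^sub>R x) = r * q x" if "r \<ge> 0" for r x
  proof (cases "r = 0")
    case False
    then have "r > 0" using that by simp
    have "q x \<le> inverse r * q (r *\<^sub>R x)"
      using le[of "inverse r" "r *\<^sub>R x"] \<open>r > 0\<close> by simp
    then have "r * q x \<le> q (r *\<^sub>R x)"
      using \<open>r > 0\<close> by (simp add: field_simps)
    then show ?thesis using le[OF \<open>r > 0\<close>, of x] by simp
  qed (simp add: \<open>q 0 = 0\<close>)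
  then show ?thesis using assms by (simp add: sublinear_def)
qed

text \<open>The infimum of the right-hand side over \<open>t\<close> is finite, since subadditivity
  bounds every term below by \<open>- q (- x)\<close>. At \<open>t = 0\<close> it lies below
  \<open>q\<close>; at \<open>t = 1\<close> it gives \<open>q' (- x0) \<le> - q x0\<close>, so a
  linear functional below \<open>q'\<close> must take the value \<open>q x0\<close> at
  \<open>x0\<close>.\<close>

lemma sublinear_shift:
  assumes q: "sublinear q"
  obtains q' where "sublinear q'" "\<And>x t. t \<ge> 0 \<Longrightarrow> q' x \<le> q (x + t *\<^sub>R x0) - t * q x0"
proof -
  define A where "A x t = q (x + t *\<^sub>R x0) - t * q x0" for x t
  define q' where "q' x = (INF t\<in>{0..}. A x t)" for x
  have "- q (- x) \<le> A x t" if "t \<ge> 0" for x t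
    using sublinear_add[OF q, of "x + t *\<^sub>R x0" "- x"] sublinear_scaleR[OF q that, of x0]
    by (simp add: A_def)
  then have bdd: "bdd_below (A x ` {0..})" for x
    by (intro bdd_belowI2[of _ "- q (- x)"]) auto
  have le: "q' x \<le> A x t" if "t \<ge> 0" for x t
    unfolding q'_def using bdd that by (intro cINF_lower) auto
  have ge: "c \<le> q' x" if "\<And>t. t \<ge> 0 \<Longrightarrow> c \<le> A x t" for c x
    unfolding q'_def using that by (intro cINF_greatest) auto
  have "sublinear q'"
  proof (rule sublinearI)
    fix x y
    have "q' (x + y) \<le> A x t + A y u" if "t \<ge> 0" "u \<ge> 0" for t u
      using le[of "t + u" "x + y"] that sublinear_add[OF q, of "x + t *\<^sub>R x0" "y + u *\<^sub>R x0"]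
      by (simp add: A_def algebra_simps)
    then have "q' (x + y) - A x t \<le> q' y" if "t \<ge> 0" for t
      using that by (intro ge) (simp add: algebra_simps)
    then have "q' (x + y) - q' y \<le> q' x"
      by (intro ge) (simp add: algebra_simps)
    then show "q' (x + y) \<le> q' x + q' y" by simp
  next
    fix r :: real and x assume r: "r > 0"
    have "q' (r *\<^sub>R x) / r \<le> q' x"
    proof (rule ge)
      fix t :: real assume "t \<ge> 0"
      then have "q' (r *\<^sub>R x) \<le> A (r *\<^sub>R x) (r * t)"
        using r by (intro le) simp
      also have "\<dots> = r * A x t"
        using sublinear_scaleR[OF q, of r "x + t *\<^sub>R x0"] r by (simp add: A_def algebra_simps)
      finally show "q' (r *\<^sub>R x) / r \<le> A x t"
        using r by (simp add: field_simps)
    qed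
    then show "q' (r *\<^sub>R x) \<le> r * q' x" using r by (simp add: field_simps)
  next
    have "A 0 t = 0" if "t \<ge> 0" for t
      using that sublinear_scaleR[OF q] by (simp add: A_def)
    then have "A 0 ` {0..} = {0}" by auto
    then show "q' 0 = 0" by (simp add: q'_def)
  qed
  with le show thesis using that unfolding A_def by blast
qed

text \<open>Zorn's lemma for the pointwise order. The bound \<open>- q (- x)\<close> is common to
  all sublinear functionals below \<open>q\<close>, so a nonempty chain of them has a finite
  pointwise infimum.\<close>

lemma minimal_sublinear_below:
  assumes q: "sublinear q"
  obtains s where "sublinear s" "\<And>x. s x \<le> q x"
    "\<And>s'. sublinear s' \<Longrightarrow> (\<And>x. s' x \<le> s x) \<Longrightarrow> s' = s"
proof -
  define A where "A = {s. sublinear s \<and> s \<le> q}"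
  \<comment> \<open>The order is reversed, so that the maximal element supplied by Zorn's lemma is a
    minimal functional.\<close>
  define P where "P = (\<lambda>a b :: 'a \<Rightarrow> real. b \<le> a)"
  have po: "partial_order_on A (relation_of P A)"
    by (auto simp: partial_order_on_def preorder_on_def refl_on_def trans_def antisym_def
        relation_of_def P_def)
  have "\<exists>u\<in>A. \<forall>a\<in>C. P a u" if C: "C \<in> Chains (relation_of P A)" for C
  proof (cases "C = {}")
    case True
    then show ?thesis using q by (auto simp: A_def)
  next
    case False
    have CA: "sublinear c" "c x \<le> q x" if "c \<in> C" for c x
      using C that by (auto simp: Chains_def relation_of_def A_def le_fun_def)
    have cmp: "c \<le> d \<or> d \<le> c" if "c \<in> C" "d \<in> C" for c d
      using C that by (auto simp: Chains_def relation_of_def P_def)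
    define m where "m x = (INF c\<in>C. c x)" for x
    have "- q (- x) \<le> c x" if "c \<in> C" for c x
      using CA(2)[OF that, of "- x"] sublinear_minus[OF CA(1)[OF that], of x] by linarith
    then have bdd: "bdd_below ((\<lambda>c. c x) ` C)" for x
      by (intro bdd_belowI2) auto
    have le: "m x \<le> c x" if "c \<in> C" for c x
      unfolding m_def using bdd that by (intro cINF_lower) auto
    have ge: "b \<le> m x" if "\<And>c. c \<in> C \<Longrightarrow> b \<le> c x" for b x
      unfolding m_def using that False by (intro cINF_greatest) auto
    have "sublinear m"
    proof (rule sublinearI)
      fix x y
      have "m (x + y) \<le> c x + d y" if cd: "c \<in> C" "d \<in> C" for c d
      proof -
        \<comment> \<open>Subadditivity of the infimum needs one functional below both
          \<open>c\<close> and \<open>d\<close>; in a chain the smaller of the two serves.\<close>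
        obtain e where e: "e \<in> C" "e \<le> c" "e \<le> d" using cmp[OF cd] cd by auto
        have "m (x + y) \<le> e x + e y"
          using le[OF e(1), of "x + y"] sublinear_add[OF CA(1)[OF e(1)], of x y] by simp
        also have "\<dots> \<le> c x + d y" using e by (intro add_mono) (auto simp: le_fun_def)
        finally show ?thesis .
      qed
      then have "m (x + y) - c x \<le> m y" if "c \<in> C" for c
        using that by (intro ge) (simp add: diff_le_eq add.commute[of _ "c x"])
      then have "m (x + y) - m y \<le> m x"
        by (intro ge) (simp add: algebra_simps)
      then show "m (x + y) \<le> m x + m y" by simp
    next
      fix r :: real and x assume r: "r > 0"
      have "m (r *\<^sub>R x) / r \<le> m x"
      proof (rule ge)
        fix c assume c: "c \<in> C"
        have "m (r *\<^sub>R x) \<le> r * c x"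
          using le[OF c, of "r *\<^sub>R x"] sublinear_scaleR[OF CA(1)[OF c]] r by simp
        then show "m (r *\<^sub>R x) / r \<le> c x" using r by (simp add: field_simps)
      qed
      then show "m (r *\<^sub>R x) \<le> r * m x" using r by (simp add: field_simps)
    next
      have "(\<lambda>c. c 0) ` C = {0}"
        using False by (auto simp: sublinear_0[OF CA(1)])
      then show "m 0 = 0" by (simp add: m_def)
    qed
    moreover obtain c where "c \<in> C" using False by auto
    then have "m \<le> q" using CA(2) by (auto simp: le_fun_def intro!: order_trans[OF le])
    ultimately show ?thesis using le by (auto simp: A_def P_def le_fun_def)
  qed
  then obtain s where s: "s \<in> A" "\<And>s'. s' \<in> A \<Longrightarrow> s' \<le> s \<Longrightarrow> s' = s"
    using predicate_Zorn[OF po] by (auto simp: P_def)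
  show thesis
  proof (rule that)
    show "sublinear s" "\<And>x. s x \<le> q x" using s(1) by (auto simp: A_def le_fun_def)
    fix s' assume "sublinear s'" "\<And>x. s' x \<le> s x"
    moreover from this have "s' \<le> q"
      using s(1) order.trans[of s' s q] by (simp add: A_def le_fun_def)
    ultimately show "s' = s" by (intro s) (auto simp: A_def le_fun_def)
  qed
qed

text \<open>A minimal sublinear functional \<open>s\<close> is linear because replacing \<open>s x\<close> by the infimum of
  \<open>s (x + t *\<^sub>R y) - t * s y\<close> over \<open>t \<ge> 0\<close> does not make it smaller.\<close>

lemma hahn_banach_sublinear:
  fixes q :: "'a::real_vector \<Rightarrow> real"
  assumes q: "sublinear q"
  obtains f where "linear f" "\<And>x. f x \<le> q x" "f x0 = q x0"
proof -
  \<comment> \<open>Minimising below the shifted functional instead of \<open>q\<close> itself is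
    what pins the value at \<open>x0\<close>.\<close>
  obtain q' where q': "sublinear q'" "\<And>x t. t \<ge> 0 \<Longrightarrow> q' x \<le> q (x + t *\<^sub>R x0) - t * q x0"
    using sublinear_shift[OF q] by blast
  obtain s where s: "sublinear s" "\<And>x. s x \<le> q' x"
    and min: "\<And>s'. sublinear s' \<Longrightarrow> (\<And>x. s' x \<le> s x) \<Longrightarrow> s' = s"
    using minimal_sublinear_below[OF q'(1)] by blast
  have add: "s (x + y) = s x + s y" for x y
  proof -
    obtain s' where s': "sublinear s'" "\<And>x t. t \<ge> 0 \<Longrightarrow> s' x \<le> s (x + t *\<^sub>R y) - t * s y"
      using sublinear_shift[OF s(1)] by blast
    have "s' = s" using s'(2)[of 0] by (intro min s') simp
    then show ?thesis using s'(2)[of 1 x] sublinear_add[OF s(1), of x y] by simp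
  qed
  have neg: "s (- x) = - s x" for x
    using add[of x "- x"] sublinear_0[OF s(1)] by simp
  have "linear s"
  proof
    show "s (x + y) = s x + s y" for x y by (rule add)
    show "s (r *\<^sub>R x) = r *\<^sub>R s x" for r x
    proof (cases "r \<ge> 0")
      case False
      then have "s (- ((- r) *\<^sub>R x)) = r * s x"
        using sublinear_scaleR[OF s(1), of "- r" x] by (simp only: neg)
      then show ?thesis by simp
    qed (simp add: sublinear_scaleR[OF s(1)])
  qed
  moreover have le: "s x \<le> q x" for x
    using s(2)[of x] q'(2)[of 0 x] by simp
  moreover have "s (- x0) \<le> - q x0"
    using s(2)[of "- x0"] q'(2)[of 1 "- x0"] sublinear_0[OF q] by simp
  then have "s x0 = q x0" using neg[of x0] le[of x0] by simp
  ultimately show thesis using that by blast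
qed

section \<open>Separating a point from a subspace\<close>

interpretation scaleC: vector_space "scaleC :: complex \<Rightarrow> 'a \<Rightarrow> 'a::complex_banach_space"
  by (rule vector_space_scaleC)

lemma scaleC_subspace_scaleR:
  "scaleC.subspace F \<Longrightarrow> x \<in> F \<Longrightarrow> r *\<^sub>R x \<in> F"
  by (simp add: scaleC_of_real[symmetric] scaleC.subspace_scale)

lemma scaleC_subspace_nonempty: "scaleC.subspace F \<Longrightarrow> F \<noteq> {}"
  using scaleC.subspace_0 by auto

lemma infdist_greatest:
  assumes "F \<noteq> {}" "\<And>f. f \<in> F \<Longrightarrow> b \<le> dist x f"
  shows "b \<le> infdist x F"
  using assms by (auto simp: infdist_def intro: cINF_greatest)

text \<open>The distance to \<open>F\<close> is a suitable majorant for Hahn-Banach: a linear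
  functional below it is bounded by the norm and vanishes on \<open>F\<close>.\<close>

lemma sublinear_infdist:
  fixes F :: "'a::complex_banach_space set"
  assumes F: "scaleC.subspace F"
  shows "sublinear (\<lambda>x. infdist x F)"
proof (rule sublinearI)
  note ge = infdist_greatest[OF scaleC_subspace_nonempty[OF F]]
  fix x y :: 'a
  have "infdist (x + y) F \<le> dist x f + dist y g" if "f \<in> F" "g \<in> F" for f g
  proof -
    have "infdist (x + y) F \<le> dist (x + y) (f + g)"
      using that by (intro infdist_le scaleC.subspace_add[OF F])
    also have "\<dots> \<le> dist x f + dist y g"
      using norm_diff_triangle_ineq[of x y f g] by (simp add: dist_norm)
    finally show ?thesis .
  qed
  then have "infdist (x + y) F - dist x f \<le> infdist y F" if "f \<in> F" for f
    using that by (intro ge) (simp add: algebra_simps)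
  then have "infdist (x + y) F - infdist y F \<le> infdist x F"
    by (intro ge) (simp add: algebra_simps)
  then show "infdist (x + y) F \<le> infdist x F + infdist y F" by simp
next
  note ge = infdist_greatest[OF scaleC_subspace_nonempty[OF F]]
  fix r :: real and x :: 'a assume r: "r > 0"
  have "infdist (r *\<^sub>R x) F / r \<le> infdist x F"
  proof (rule ge)
    fix f assume "f \<in> F"
    then have "infdist (r *\<^sub>R x) F \<le> dist (r *\<^sub>R x) (r *\<^sub>R f)"
      by (intro infdist_le scaleC_subspace_scaleR[OF F])
    also have "\<dots> = r * dist x f"
      using r by (simp add: dist_norm flip: scaleR_diff_right)
    finally show "infdist (r *\<^sub>R x) F / r \<le> dist x f"
      using r by (simp add: field_simps)
  qed
  then show "infdist (r *\<^sub>R x) F \<le> r * infdist x F" using r by (simp add: field_simps)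
qed (simp add: infdist_zero scaleC.subspace_0[OF F])

text \<open>A real functional \<open>u\<close> below the distance to \<open>F\<close>, with equality
  at \<open>x0\<close>, is complexified to one that still kills \<open>F\<close>; the hypothesis
  then makes the distance of \<open>x0\<close> zero.\<close>

lemma mem_closure_if_annihilators:
  fixes F :: "'a::complex_banach_space set"
  assumes F: "scaleC.subspace F"
    and ann: "\<And>f. f \<in> complex_normed_on.dual scaleC UNIV norm \<Longrightarrow> (\<And>x. x \<in> F \<Longrightarrow> f x = 0)
      \<Longrightarrow> f x0 = 0"
  shows "x0 \<in> closure F"
proof -
  interpret U: complex_banach_on scaleC "UNIV :: 'a set" norm
    by (rule complex_banach_on_UNIV)
  obtain u where u: "linear u" "\<And>x. u x \<le> infdist x F" "u x0 = infdist x0 F"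
    using hahn_banach_sublinear[OF sublinear_infdist[OF F]] by blast
  interpret u: linear u by fact
  \<comment> \<open>The only complex-linear functional with real part \<open>u\<close>.\<close>
  define f where "f x = Complex (u x) (- u (scaleC \<i> x))" for x
  have ne: "F \<noteq> {}" using F by (rule scaleC_subspace_nonempty)
  have abs_le: "\<bar>u x\<bar> \<le> infdist x F" for x
  proof -
    have "infdist (- x) F \<le> infdist x F"
    proof -
      have "infdist (- x) F \<le> dist x f" if "f \<in> F" for f
      proof -
        have "infdist (- x) F \<le> dist (- x) (- f)"
          using scaleC.subspace_neg[OF F that] by (rule infdist_le)
        then show ?thesis by (simp add: dist_minus)
      qed
      then show ?thesis by (rule infdist_greatest[OF ne])
    qed
    then show ?thesis using u(2)[of x] u(2)[of "- x"] u.neg[of x] by auto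
  qed
  have "infdist x F \<le> norm x" for x
    using infdist_le[OF scaleC.subspace_0[OF F], of x] by simp
  then have bound: "\<bar>u x\<bar> \<le> norm x" for x
    using abs_le by (meson order_trans)
  have ker: "x \<in> F \<Longrightarrow> u x = 0" for x
    using abs_le[of x] infdist_zero[of x F] by simp
  have I: "scaleC c x = Re c *\<^sub>R x + Im c *\<^sub>R scaleC \<i> x" for c and x :: 'a
  proof -
    have "c = of_real (Re c) + of_real (Im c) * \<i>" by (simp add: complex_eq_iff)
    then have "scaleC c x = scaleC (of_real (Re c) + of_real (Im c) * \<i>) x" by simp
    then show ?thesis
      by (simp only: scaleC_add_left scaleC_of_real flip: scaleC_scaleC)
  qed
  have "f \<in> U.dual"
    unfolding U.dual_def
  proof (intro CollectI conjI ballI allI exI)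
    show "f (x + y) = f x + f y" for x y
      by (simp add: f_def scaleC_add_right u.add complex_eq_iff)
    show "f (scaleC c x) = c * f x" for c x
    proof -
      have "scaleC \<i> (scaleC c x) = Re c *\<^sub>R scaleC \<i> x - Im c *\<^sub>R x"
        unfolding scaleC_scaleC I[of "\<i> * c" x] by simp
      then show ?thesis
        by (simp add: f_def I[of c] u.add u.diff u.scale complex_eq_iff)
    qed
    \<comment> \<open>The factor 2 comes from estimating real and imaginary part separately; any
      finite bound will do.\<close>
    show "cmod (f x) \<le> 2 * norm x" for x
      using cmod_le[of "f x"] bound[of x] bound[of "scaleC \<i> x"]
      by (simp add: f_def norm_scaleC)
  qed simp
  moreover have "f x = 0" if "x \<in> F" for x
    using that scaleC.subspace_scale[OF F that] by (simp add: f_def ker complex_eq_iff)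
  ultimately have "f x0 = 0" by (rule ann)
  then have "infdist x0 F = 0" by (simp add: f_def complex_eq_iff u(3))
  then show ?thesis using ne by (simp add: in_closure_iff_infdist_zero)
qed

section \<open>The closed graph theorem\<close>

text \<open>Baire's theorem yields a ball in which a sublevel set of the norm of \<open>f\<close> is
  dense. By linearity every \<open>x\<close> is then approximated up to half its norm by a point
  with controlled image, and iterating the correction writes \<open>x\<close> as a series whose
  images converge absolutely.\<close>

theorem closed_graph:
  fixes f :: "'a::banach \<Rightarrow> 'b::banach"
  assumes f: "linear f"
    and graph: "\<And>u x y. u \<longlonglongrightarrow> x \<Longrightarrow> (\<lambda>n. f (u n)) \<longlonglongrightarrow> y \<Longrightarrow> f x = y"
  shows "bounded_linear f"
proof -
  interpret f: linear f by fact
  define V where "V n = {x. norm (f x) \<le> real n}" for n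
  \<comment> \<open>\<open>V n\<close> is not known to be closed, so Baire's theorem is applied to
    the closures.\<close>
  have "\<exists>n. interior (closure (V n)) \<noteq> {}"
  proof (rule ccontr)
    assume "\<not> ?thesis"
    then have "euclidean interior_of (\<Union>n. closure (V n)) = {}"
      by (intro Baire_category_alt)
        (auto simp: completely_metrizable_space_euclidean)
    moreover have "(\<Union>n. closure (V n)) = UNIV"
    proof -
      have "x \<in> closure (V (nat \<lceil>norm (f x)\<rceil>))" for x
        by (intro subsetD[OF closure_subset]) (simp add: V_def of_nat_ceiling)
      then show ?thesis by blast
    qed
    ultimately show False by simp
  qed
  then obtain n z where "z \<in> interior (closure (V n))" by blast
  then obtain r where r: "r > 0" "ball z r \<subseteq> closure (V n)"
    by (auto simp: mem_interior)
  \<comment> \<open>Half the difference of approximants of \<open>z + y\<close> and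
    \<open>z - y\<close> approximates \<open>y\<close>. This moves the ball from \<open>z\<close> to
    the origin without enlarging the bound \<open>n\<close>.\<close>
  have near: "\<exists>w. norm (f w) \<le> real n \<and> norm (y - w) \<le> e" if y: "norm y < r" and e: "e > 0" for y e
  proof -
    have "z + y \<in> closure (V n)" "z - y \<in> closure (V n)"
      using r y by (auto simp: dist_norm subset_iff)
    then obtain u v where uv: "u \<in> V n" "dist u (z + y) < e" "v \<in> V n" "dist v (z - y) < e"
      using e by (meson closure_approachable)
    have "norm (f (u - v)) \<le> real n + real n"
      using uv norm_triangle_ineq4[of "f u" "f v"] by (simp add: V_def f.diff)
    moreover have "norm ((z + y - u) - (z - y - v)) \<le> e + e"
      using uv norm_triangle_ineq4[of "z + y - u" "z - y - v"]
      by (simp add: dist_norm norm_minus_commute)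
    moreover have "y - (1/2) *\<^sub>R (u - v) = (1/2) *\<^sub>R ((z + y - u) - (z - y - v))"
      by (simp add: algebra_simps) (simp flip: scaleR_add_left)
    ultimately show ?thesis
      by (intro exI[of _ "(1/2) *\<^sub>R (u - v)"]) (simp add: f.scale)
  qed
  \<comment> \<open>Scaling \<open>x\<close> to norm \<open>r / 2\<close> and scaling the
    approximant back multiplies the bound \<open>n\<close> by \<open>2 * norm x / r\<close>.\<close>
  define C where "C = 2 * real n / r"
  have C: "C \<ge> 0" using r by (simp add: C_def)
  have "\<exists>w. norm (f w) \<le> C * norm x \<and> norm (x - w) \<le> norm x / 2" for x
  proof (cases "x = 0")
    case True
    then show ?thesis by (intro exI[of _ 0]) (simp add: f.zero)
  next
    case False
    define s where "s = r / (2 * norm x)"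
    have s: "s > 0" using False r by (simp add: s_def)
    have "norm (s *\<^sub>R x) < r" using False r by (simp add: s_def)
    then obtain w where w: "norm (f w) \<le> real n" "norm (s *\<^sub>R x - w) \<le> s * norm x / 2"
      using near[of "s *\<^sub>R x" "s * norm x / 2"] False s by auto
    have "norm (f (inverse s *\<^sub>R w)) \<le> C * norm x"
      using w(1) False r by (simp add: f.scale s_def C_def field_simps)
    moreover have "x - inverse s *\<^sub>R w = inverse s *\<^sub>R (s *\<^sub>R x - w)"
      using s by (simp add: algebra_simps)
    then have "norm (x - inverse s *\<^sub>R w) = norm (s *\<^sub>R x - w) / s"
      using s by (simp add: divide_inverse mult.commute)
    then have "norm (x - inverse s *\<^sub>R w) \<le> norm x / 2"
      using w(2) s by (simp add: divide_le_eq mult.commute)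
    ultimately show ?thesis by blast
  qed
  then obtain W where W: "\<And>x. norm (f (W x)) \<le> C * norm x" "\<And>x. norm (x - W x) \<le> norm x / 2"
    by metis
  have "norm (f x) \<le> norm x * (2 * C)" for x
  proof -
    \<comment> \<open>The error left after \<open>k\<close> corrections, at least halved each time.
      The corrections so far add up to \<open>x - u m\<close>, the sequence to which
      \<open>graph\<close> is applied; the geometric series contributes the factor 2.\<close>
    define u where "u k = ((\<lambda>y. y - W y) ^^ k) x" for k
    have u_Suc: "u (Suc k) = u k - W (u k)" for k by (simp add: u_def)
    have u: "norm (u k) \<le> norm x * (1/2) ^ k" for k
    proof (induction k)
      case (Suc k)
      then show ?case using W(2)[of "u k"] by (simp add: u_Suc)
    qed (simp add: u_def)
    have partial: "(\<Sum>k<m. W (u k)) = x - u m" for m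
      by (induction m) (simp_all add: u_Suc, simp add: u_def)
    have W_le: "norm (f (W (u k))) \<le> C * norm x * (1/2) ^ k" for k
      using W(1)[of "u k"] mult_left_mono[OF u[of k] C] by (simp add: mult.assoc)
    have geo: "(\<lambda>k. C * norm x * (1/2) ^ k) sums (C * norm x * 2)"
      using sums_mult[OF geometric_sums[of "1/2 :: real"], of "C * norm x"] by simp
    have summ: "summable (\<lambda>k. norm (f (W (u k))))"
      by (rule summable_comparison_test'[OF sums_summable[OF geo]]) (simp add: W_le)
    have "(\<lambda>m. norm x * (1/2) ^ m) \<longlonglongrightarrow> 0"
      by (intro tendsto_mult_right_zero LIMSEQ_power_zero) simp
    then have "u \<longlonglongrightarrow> 0"
      by (rule Lim_null_comparison[rotated]) (simp add: u)
    then have "(\<lambda>m. x - u m) \<longlonglongrightarrow> x"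
      using tendsto_diff[OF tendsto_const[of x]] by fastforce
    moreover have "(\<lambda>m. f (x - u m)) \<longlonglongrightarrow> (\<Sum>k. f (W (u k)))"
      using summable_LIMSEQ[OF summable_norm_cancel[OF summ]]
      by (simp add: f.sum flip: partial)
    ultimately have "f x = (\<Sum>k. f (W (u k)))" by (rule graph)
    also have "norm \<dots> \<le> (\<Sum>k. norm (f (W (u k))))"
      by (rule summable_norm[OF summ])
    also have "\<dots> \<le> (\<Sum>k. C * norm x * (1/2) ^ k)"
      by (rule suminf_le[OF W_le summ sums_summable[OF geo]])
    also have "\<dots> = norm x * (2 * C)"
      using geo by (simp add: sums_iff)
    finally show ?thesis .
  qed
  then show ?thesis by (intro bounded_linear_intro[of _ "2 * C"] f.add f.scale)
qed

section \<open>Multipliers\<close>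

lemma multiplierD: "(L, R) \<in> multipliers \<Longrightarrow> a * L b = R a * b"
  by (simp add: multipliers_def)

context
  assumes faithful: "faithful_algebra TYPE('a::complex_banach_algebra)"
begin

lemma faithful_left:
  assumes "\<And>c. c * x = c * y" shows "x = (y :: 'a)"
proof -
  have "a * (x - y) * b = 0" for a b using assms[of a] by (simp add: algebra_simps)
  then show ?thesis using faithful unfolding faithful_algebra_def by (metis eq_iff_diff_eq_0)
qed

lemma faithful_right:
  assumes "\<And>c. x * c = y * c" shows "x = (y :: 'a)"
proof -
  have "a * (x - y) * b = 0" for a b
    using assms[of b] by (simp add: mult.assoc left_diff_distrib)
  then show ?thesis using faithful unfolding faithful_algebra_def by (metis eq_iff_diff_eq_0)
qed

context
  fixes L R :: "'a \<Rightarrow> 'a"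
  assumes LR: "(L, R) \<in> multipliers"
begin

text \<open>In \<open>c * L b = R c * b\<close> the right-hand side is linear in \<open>b\<close>,
  and \<open>c\<close> can be cancelled on the left; for \<open>R\<close> the other factor is
  cancelled on the right.\<close>

lemma multiplier_add:
  "L (a + b) = L a + L b" "R (a + b) = R a + R b"
  by (rule faithful_left, simp add: distrib_left multiplierD[OF LR])
    (rule faithful_right, simp add: distrib_right flip: multiplierD[OF LR])

lemma multiplier_scaleC:
  "L (scaleC c a) = scaleC c (L a)" "R (scaleC c a) = scaleC c (R a)"
  by (rule faithful_left, simp add: mult_scaleC_right multiplierD[OF LR])
    (rule faithful_right, simp add: mult_scaleC_left flip: multiplierD[OF LR])

lemma multiplier_linear: "linear L" "linear R"
  by (auto intro!: linearI simp: multiplier_add multiplier_scaleC simp flip: scaleC_of_real)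

text \<open>For the closed graph theorem, multiplying by an arbitrary \<open>c\<close> turns
  \<open>L (u n)\<close> into \<open>R c * u n\<close>, whose limit is known because multiplication
  by the fixed element \<open>R c\<close> is continuous.\<close>

lemma multiplier_bounded_linear: "bounded_linear L" "bounded_linear R"
proof -
  show "bounded_linear L"
  proof (rule closed_graph[OF multiplier_linear(1)])
    fix u x y assume u: "u \<longlonglongrightarrow> x" and y: "(\<lambda>n. L (u n)) \<longlonglongrightarrow> y"
    show "L x = y"
    proof (rule faithful_left)
      fix c
      have "(\<lambda>n. R c * u n) \<longlonglongrightarrow> R c * x" by (intro tendsto_intros u)
      moreover have "(\<lambda>n. c * L (u n)) \<longlonglongrightarrow> c * y" by (intro tendsto_intros y)
      ultimately show "c * L x = c * y"
        unfolding multiplierD[OF LR] by (rule LIMSEQ_unique)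
    qed
  qed
  show "bounded_linear R"
  proof (rule closed_graph[OF multiplier_linear(2)])
    fix u x y assume u: "u \<longlonglongrightarrow> x" and y: "(\<lambda>n. R (u n)) \<longlonglongrightarrow> y"
    show "R x = y"
    proof (rule faithful_right)
      fix c
      have "(\<lambda>n. u n * L c) \<longlonglongrightarrow> x * L c" by (intro tendsto_intros u)
      moreover have "(\<lambda>n. R (u n) * c) \<longlonglongrightarrow> y * c" by (intro tendsto_intros y)
      ultimately show "R x * c = y * c"
        unfolding multiplierD[OF LR] by (rule LIMSEQ_unique)
    qed
  qed
qed

lemma mult_norm_ge:
  "norm (L a) \<le> mult_norm (L, R) * norm a" "norm (R a) \<le> mult_norm (L, R) * norm a"
proof -
  show "norm (L a) \<le> mult_norm (L, R) * norm a"
    by (rule order_trans[OF onorm[OF multiplier_bounded_linear(1)]])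
      (simp add: mult_norm_def mult_right_mono)
  show "norm (R a) \<le> mult_norm (L, R) * norm a"
    by (rule order_trans[OF onorm[OF multiplier_bounded_linear(2)]])
      (simp add: mult_norm_def mult_right_mono)
qed

lemma mult_norm_nonneg: "0 \<le> mult_norm (L, R)"
  by (simp add: mult_norm_def le_max_iff_disj onorm_pos_le multiplier_bounded_linear)

end

end

section \<open>The Banach algebra of multipliers\<close>

lemma mult_norm_le:
  assumes "0 \<le> K" "\<And>a. norm (L a) \<le> K * norm a" "\<And>a. norm (R a) \<le> K * norm a"
  shows "mult_norm (L, R) \<le> K"
  unfolding mult_norm_def using assms by (auto intro: onorm_bound)

lemma vector_space_mult_scale:
  "vector_space (mult_scale :: complex \<Rightarrow> 'a::complex_banach_algebra map_pair \<Rightarrow> _)"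
proof
  show "mult_scale 1 x = x" for x :: "'a map_pair"
    by (simp add: mult_scale_def split_beta)
qed (auto simp: mult_scale_def scaleC_add_right scaleC_add_left scaleC_scaleC fun_eq_iff)

text \<open>For completeness: the identity \<open>a * L b = R a * b\<close> survives pointwise
  limits, so a Cauchy sequence has a pointwise limit among the multipliers, and the uniform Cauchy
  estimate upgrades the convergence to the norm.\<close>

lemma multipliers_complex_banach_algebra_on:
  assumes faithful: "faithful_algebra TYPE('a::complex_banach_algebra)"
  shows "complex_banach_algebra_on mult_scale (multipliers :: 'a map_pair set) mult_norm mult_times"
proof -
  interpret vector_space "mult_scale :: complex \<Rightarrow> 'a map_pair \<Rightarrow> 'a map_pair"
    by (rule vector_space_mult_scale)
  note ge = mult_norm_ge[OF faithful] and nonneg = mult_norm_nonneg[OF faithful]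
  have sub: "subspace (multipliers :: 'a map_pair set)"
    unfolding subspace_def
    by (auto simp: multipliers_def zero_prod_def mult_scale_def algebra_simps
        mult_scaleC_left mult_scaleC_right)
  \<comment> \<open>For nonzero \<open>c\<close> the reverse inequality follows by applying this one
    to \<open>inverse c\<close>.\<close>
  have scale_le: "mult_norm (mult_scale c x) \<le> cmod c * mult_norm x"
    if "x \<in> multipliers" for c and x :: "'a map_pair"
    using that ge nonneg
    by (cases x) (auto simp: mult_scale_def norm_scaleC mult.assoc intro!: mult_norm_le mult_left_mono)
  show ?thesis
  proof
    fix x y z :: "'a map_pair" and c
    assume x: "x \<in> multipliers"
    obtain L R where xe: "x = (L, R)" by (cases x)
    have LR: "(L, R) \<in> multipliers" using x xe by simp
    note lin = multiplier_add[OF faithful LR] multiplier_scaleC[OF faithful LR]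
    show "mult_norm x = 0 \<longleftrightarrow> x = 0"
    proof
      assume "mult_norm x = 0"
      then show "x = 0"
        using ge[OF LR] by (auto simp: xe zero_prod_def fun_eq_iff)
    next
      assume "x = 0"
      then have "mult_norm x \<le> 0" by (auto simp: zero_prod_def intro!: mult_norm_le)
      then show "mult_norm x = 0" using nonneg[OF LR] xe by simp
    qed
    show "mult_norm (mult_scale c x) = cmod c * mult_norm x"
    proof (cases "c = 0")
      case True
      have "mult_norm (mult_scale c x) \<le> 0" using scale_le[OF x, of c] True by simp
      moreover have "mult_scale c x \<in> multipliers" using subspace_scale[OF sub x] .
      then have "0 \<le> mult_norm (mult_scale c x)" using nonneg by (cases "mult_scale c x") auto
      ultimately show ?thesis using True by simp
    next
      case False
      have "mult_norm (mult_scale (inverse c) (mult_scale c x))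
          \<le> cmod (inverse c) * mult_norm (mult_scale c x)"
        by (intro scale_le subspace_scale[OF sub x])
      then have "cmod c * mult_norm x \<le> mult_norm (mult_scale c x)"
        using False by (simp add: norm_inverse norm_divide field_simps)
      then show ?thesis using scale_le[OF x, of c] by simp
    qed
    assume y: "y \<in> multipliers"
    obtain L' R' where ye: "y = (L', R')" by (cases y)
    have LR': "(L', R') \<in> multipliers" using y ye by simp
    show "mult_norm (x + y) \<le> mult_norm x + mult_norm y"
      unfolding xe ye using ge[OF LR] ge[OF LR'] nonneg[OF LR] nonneg[OF LR']
      by (auto intro!: mult_norm_le norm_triangle_le add_mono simp: distrib_right)
    show "mult_times x y \<in> multipliers"
      using LR LR' by (simp add: xe ye mult_times_def multipliers_def)
    have "norm (L (L' a)) \<le> mult_norm x * mult_norm y * norm a"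
      "norm (R' (R a)) \<le> mult_norm x * mult_norm y * norm a" for a
      using order_trans[OF ge(1)[OF LR, of "L' a"] mult_left_mono[OF ge(1)[OF LR', of a] nonneg[OF LR]]]
        order_trans[OF ge(2)[OF LR', of "R a"] mult_left_mono[OF ge(2)[OF LR, of a] nonneg[OF LR']]]
      by (simp_all add: xe ye ac_simps)
    then show "mult_norm (mult_times x y) \<le> mult_norm x * mult_norm y"
      using nonneg[OF LR] nonneg[OF LR']
      by (auto simp: mult_times_def xe ye intro!: mult_norm_le)
    show "mult_times (mult_scale c x) y = mult_scale c (mult_times x y)"
      using multiplier_scaleC[OF faithful LR'] by (auto simp: xe ye mult_times_def mult_scale_def)
    show "mult_times x (mult_scale c y) = mult_scale c (mult_times x y)"
      using lin by (auto simp: xe ye mult_times_def mult_scale_def)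
    assume z: "z \<in> multipliers"
    obtain L'' R'' where ze: "z = (L'', R'')" by (cases z)
    show "mult_times (mult_times x y) z = mult_times x (mult_times y z)"
      by (auto simp: xe ye ze mult_times_def)
    show "mult_times (x + y) z = mult_times x z + mult_times y z"
      using multiplier_add[OF faithful, of L'' R''] z by (auto simp: xe ye ze mult_times_def)
    show "mult_times x (y + z) = mult_times x y + mult_times x z"
      using lin by (auto simp: xe ye ze mult_times_def)
  next
    fix \<sigma> :: "nat \<Rightarrow> 'a map_pair"
    assume \<sigma>: "\<And>n. \<sigma> n \<in> multipliers"
      and cauchy: "\<And>e. e > 0 \<Longrightarrow> \<exists>k. \<forall>m\<ge>k. \<forall>n\<ge>k. mult_norm (\<sigma> m - \<sigma> n) < e"
    define L R where "L n = fst (\<sigma> n)" and "R n = snd (\<sigma> n)" for n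
    have \<sigma>e: "\<sigma> n = (L n, R n)" for n by (simp add: L_def R_def)
    have diff: "\<sigma> m - \<sigma> n \<in> multipliers" for m n by (intro subspace_diff sub \<sigma>)
    have le: "norm (L m a - L n a) \<le> mult_norm (\<sigma> m - \<sigma> n) * norm a"
      "norm (R m a - R n a) \<le> mult_norm (\<sigma> m - \<sigma> n) * norm a" for m n a
      using ge[of "L m - L n" "R m - R n" a] diff[of m n] by (simp_all add: \<sigma>e)
    have "\<exists>k. \<forall>m\<ge>k. \<forall>n\<ge>k. norm (L m a - L n a) < e \<and> norm (R m a - R n a) < e"
      if e: "e > 0" for a e
    proof -
      have "e / (norm a + 1) > 0" using e by (simp add: add_nonneg_pos)
      from cauchy[OF this] obtain k
        where k: "mult_norm (\<sigma> m - \<sigma> n) < e / (norm a + 1)" if "m \<ge> k" "n \<ge> k" for m n by blast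
      have "mult_norm (\<sigma> m - \<sigma> n) * norm a < e" if "m \<ge> k" "n \<ge> k" for m n
      proof -
        have "mult_norm (\<sigma> m - \<sigma> n) * norm a \<le> e / (norm a + 1) * norm a"
          using k[OF that] by (intro mult_right_mono) auto
        also have "\<dots> < e"
          using e by (simp add: pos_divide_less_eq add_nonneg_pos distrib_left)
        finally show ?thesis .
      qed
      then show ?thesis using le_less_trans[OF le(1)] le_less_trans[OF le(2)] by blast
    qed
    then have "Cauchy (\<lambda>n. L n a)" "Cauchy (\<lambda>n. R n a)" for a
      unfolding Cauchy_def dist_norm by blast+
    then obtain L' R' where lim: "\<And>a. (\<lambda>n. L n a) \<longlonglongrightarrow> L' a" "\<And>a. (\<lambda>n. R n a) \<longlonglongrightarrow> R' a"
      unfolding Cauchy_convergent_iff convergent_def by metis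
    have "a * L' b = R' a * b" for a b
    proof (rule LIMSEQ_unique)
      show "(\<lambda>n. a * L n b) \<longlonglongrightarrow> a * L' b" by (intro tendsto_intros lim)
      have "(\<lambda>n. R n a * b) \<longlonglongrightarrow> R' a * b" by (intro tendsto_intros lim)
      then show "(\<lambda>n. a * L n b) \<longlonglongrightarrow> R' a * b"
        by (simp add: multiplierD[OF \<sigma>[unfolded \<sigma>e]])
    qed
    then have mem: "(L', R') \<in> multipliers" by (simp add: multipliers_def)
    have "(\<lambda>n. mult_norm (\<sigma> n - (L', R'))) \<longlonglongrightarrow> 0"
    proof (rule LIMSEQ_I)
      fix e :: real assume "e > 0"
      then obtain k where k: "mult_norm (\<sigma> m - \<sigma> n) < e / 2" if "m \<ge> k" "n \<ge> k" for m n
        using cauchy[of "e / 2"] by auto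
      have "norm (mult_norm (\<sigma> m - (L', R')) - 0) < e" if m: "m \<ge> k" for m
      proof -
        have b: "mult_norm (\<sigma> m - \<sigma> n) * norm a \<le> e / 2 * norm a" if "n \<ge> k" for n a
          using k[OF m that] by (intro mult_right_mono) auto
        have "norm (L m a - L' a) \<le> e / 2 * norm a" for a
        proof (rule Lim_bounded)
          show "(\<lambda>n. norm (L m a - L n a)) \<longlonglongrightarrow> norm (L m a - L' a)"
            by (intro tendsto_intros lim)
          show "\<forall>n\<ge>k. norm (L m a - L n a) \<le> e / 2 * norm a"
            using order_trans[OF le(1) b] by blast
        qed
        moreover have "norm (R m a - R' a) \<le> e / 2 * norm a" for a
        proof (rule Lim_bounded)
          show "(\<lambda>n. norm (R m a - R n a)) \<longlonglongrightarrow> norm (R m a - R' a)"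
            by (intro tendsto_intros lim)
          show "\<forall>n\<ge>k. norm (R m a - R n a) \<le> e / 2 * norm a"
            using order_trans[OF le(2) b] by blast
        qed
        ultimately have "mult_norm (\<sigma> m - (L', R')) \<le> e / 2"
          unfolding \<sigma>e diff_Pair using \<open>e > 0\<close> by (intro mult_norm_le) simp_all
        moreover have "0 \<le> mult_norm (\<sigma> m - (L', R'))"
          using nonneg subspace_diff[OF sub \<sigma> mem, of m] by (simp add: \<sigma>e)
        ultimately show ?thesis using \<open>e > 0\<close> by simp
      qed
      then show "\<exists>k. \<forall>m\<ge>k. norm (mult_norm (\<sigma> m - (L', R')) - 0) < e" by blast
    qed
    then show "\<exists>x\<in>multipliers. (\<lambda>n. mult_norm (\<sigma> n - x)) \<longlonglongrightarrow> 0" using mem by blast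
  qed (rule sub)
qed

section \<open>Functionals on a carrier\<close>

lemma vector_space_pointwise:
  "vector_space (\<lambda>c (f :: 'v \<Rightarrow> complex) x. c * f x)"
  by standard (auto simp: fun_eq_iff algebra_simps)

context complex_normed_on
begin

lemma nrm_zero [simp]: "nrm 0 = 0"
  using nrm_eq_0[of 0] subspace_0[OF subspace_carrier] by simp

lemma nrm_minus: "x \<in> X \<Longrightarrow> nrm (- x) = nrm x"
  using nrm_sc[of x "-1"] by simp

lemma nrm_nonneg: "x \<in> X \<Longrightarrow> 0 \<le> nrm x"
  using nrm_triangle[of x "- x"] nrm_minus[of x] subspace_neg[OF subspace_carrier] by simp

lemma nrm_diff_triangle:
  assumes "x \<in> X" "y \<in> X" "z \<in> X"
  shows "nrm (x - z) \<le> nrm (x - y) + nrm (y - z)"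
  using nrm_triangle[of "x - y" "y - z"] assms subspace_diff[OF subspace_carrier] by simp

lemma nrm_diff_commute: "x \<in> X \<Longrightarrow> y \<in> X \<Longrightarrow> nrm (x - y) = nrm (y - x)"
  using nrm_minus[of "x - y"] subspace_diff[OF subspace_carrier, of x y] by simp

lemma bdd_above_unit_ball:
  assumes bound: "\<And>x. x \<in> X \<Longrightarrow> cmod (f x) \<le> K * nrm x"
  shows "bdd_above ((\<lambda>x. cmod (f x)) ` {x \<in> X. nrm x \<le> 1})"
proof (rule bdd_aboveI2)
  fix z assume z: "z \<in> {x \<in> X. nrm x \<le> 1}"
  have "cmod (f z) \<le> K * nrm z" using bound z by simp
  \<comment> \<open>\<open>K\<close> is not assumed nonnegative, hence its absolute value.\<close>
  also have "\<dots> \<le> \<bar>K\<bar> * nrm z" using nrm_nonneg z by (intro mult_right_mono) auto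
  also have "\<dots> \<le> \<bar>K\<bar> * 1" using z by (intro mult_left_mono) auto
  finally show "cmod (f z) \<le> \<bar>K\<bar>" by simp
qed

text \<open>Stated for bare homogeneity and boundedness because it serves functionals extended by
  \<open>undefined\<close> as well as those extended by \<open>0\<close>.\<close>

lemma dual_norm_bound:
  assumes scale: "\<And>c x. x \<in> X \<Longrightarrow> f (sc c x) = c * f x"
    and bound: "\<And>x. x \<in> X \<Longrightarrow> cmod (f x) \<le> K * nrm x" and x: "x \<in> X"
  shows "cmod (f x) \<le> dual_norm f * nrm x"
proof (cases "nrm x = 0")
  case True
  then show ?thesis using bound[OF x] by simp
next
  case False
  then have pos: "nrm x > 0" using nrm_nonneg[OF x] by simp
  define y where "y = sc (inverse (of_real (nrm x))) x"
  have y: "y \<in> X" unfolding y_def using subspace_carrier x by (rule subspace_scale)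
  have "nrm y = 1" using nrm_sc[OF x] pos by (simp add: y_def norm_inverse)
  have "bdd_above ((\<lambda>x. cmod (f x)) ` {x \<in> X. nrm x \<le> 1})"
    using bound by (rule bdd_above_unit_ball)
  then have "cmod (f y) \<le> dual_norm f"
    unfolding dual_norm_def using y \<open>nrm y = 1\<close> by (intro cSUP_upper) auto
  then show ?thesis
    using pos scale[OF x] by (simp add: y_def norm_mult norm_inverse norm_divide field_simps)
qed

lemma dual_norm_le:
  assumes "0 \<le> K" and "\<And>x. x \<in> X \<Longrightarrow> cmod (f x) \<le> K * nrm x"
  shows "dual_norm f \<le> K"
  unfolding dual_norm_def
proof (rule cSUP_least)
  show "{x \<in> X. nrm x \<le> 1} \<noteq> {}" using subspace_0[OF subspace_carrier] nrm_zero by force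
  fix z assume z: "z \<in> {x \<in> X. nrm x \<le> 1}"
  have "cmod (f z) \<le> K * nrm z" using assms z by simp
  also have "\<dots> \<le> K * 1" using z assms by (intro mult_left_mono) auto
  finally show "cmod (f z) \<le> K" by simp
qed

lemma dual_norm_nonneg:
  assumes bound: "\<And>x. x \<in> X \<Longrightarrow> cmod (f x) \<le> K * nrm x"
  shows "0 \<le> dual_norm f"
  unfolding dual_norm_def
proof (rule cSUP_upper2)
  show "bdd_above ((\<lambda>x. cmod (f x)) ` {x \<in> X. nrm x \<le> 1})"
    using bound by (rule bdd_above_unit_ball)
  show "0 \<in> {x \<in> X. nrm x \<le> 1}" using subspace_0[OF subspace_carrier] by simp
qed simp

lemma dual_apply_le: "f \<in> dual \<Longrightarrow> x \<in> X \<Longrightarrow> cmod (f x) \<le> dual_norm f * nrm x"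
  unfolding dual_def by (blast intro: dual_norm_bound)

text \<open>The dual once more, now with functionals extended by \<open>0\<close> instead of \<open>undefined\<close>, which makes
  it a subspace of the function space.\<close>

definition functionals :: "('v \<Rightarrow> complex) set" where
  "functionals = {f. (\<forall>x. x \<notin> X \<longrightarrow> f x = 0) \<and>
     (\<forall>x\<in>X. \<forall>y\<in>X. f (x + y) = f x + f y) \<and> (\<forall>c. \<forall>x\<in>X. f (sc c x) = c * f x) \<and>
     (\<exists>K. \<forall>x\<in>X. cmod (f x) \<le> K * nrm x)}"

lemma functionalsI:
  assumes "\<And>x. x \<notin> X \<Longrightarrow> f x = 0" "\<And>x y. x \<in> X \<Longrightarrow> y \<in> X \<Longrightarrow> f (x + y) = f x + f y"
    "\<And>c x. x \<in> X \<Longrightarrow> f (sc c x) = c * f x" "\<And>x. x \<in> X \<Longrightarrow> cmod (f x) \<le> K * nrm x"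
  shows "f \<in> functionals"
  using assms unfolding functionals_def by blast

lemma functionals_outside: "f \<in> functionals \<Longrightarrow> x \<notin> X \<Longrightarrow> f x = 0"
  and functionals_add: "f \<in> functionals \<Longrightarrow> x \<in> X \<Longrightarrow> y \<in> X \<Longrightarrow> f (x + y) = f x + f y"
  and functionals_scale: "f \<in> functionals \<Longrightarrow> x \<in> X \<Longrightarrow> f (sc c x) = c * f x"
  unfolding functionals_def by auto

lemma functionals_apply_le:
  "f \<in> functionals \<Longrightarrow> x \<in> X \<Longrightarrow> cmod (f x) \<le> dual_norm f * nrm x"
  unfolding functionals_def by (blast intro: dual_norm_bound)

lemma functionals_dual_norm_nonneg: "f \<in> functionals \<Longrightarrow> 0 \<le> dual_norm f"
  unfolding functionals_def by (blast intro: dual_norm_nonneg)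

lemma complex_normed_on_functionals:
  "complex_normed_on (\<lambda>c f x. c * f x) functionals dual_norm"
proof -
  interpret V: vector_space "\<lambda>c (f :: 'v \<Rightarrow> complex) x. c * f x"
    by (rule vector_space_pointwise)
  have add: "f + g \<in> functionals" "dual_norm (f + g) \<le> dual_norm f + dual_norm g"
    if f: "f \<in> functionals" and g: "g \<in> functionals" for f g
  proof -
    have le: "cmod ((f + g) x) \<le> (dual_norm f + dual_norm g) * nrm x" if "x \<in> X" for x
      using functionals_apply_le[OF f that] functionals_apply_le[OF g that]
      by (auto simp: distrib_right intro: norm_triangle_le)
    show "f + g \<in> functionals"
      by (rule functionalsI[OF _ _ _ le])
        (simp_all add: functionals_outside[OF f] functionals_outside[OF g] functionals_add[OF f]
            functionals_add[OF g] functionals_scale[OF f] functionals_scale[OF g] distrib_left)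
    show "dual_norm (f + g) \<le> dual_norm f + dual_norm g"
      by (rule dual_norm_le[OF _ le]) (simp_all add: functionals_dual_norm_nonneg f g)
  qed
  have scale: "(\<lambda>x. c * f x) \<in> functionals" "dual_norm (\<lambda>x. c * f x) \<le> cmod c * dual_norm f"
    if f: "f \<in> functionals" for c f
  proof -
    have le: "cmod (c * f x) \<le> (cmod c * dual_norm f) * nrm x" if "x \<in> X" for x
      using functionals_apply_le[OF f that] by (simp add: norm_mult mult.assoc mult_left_mono)
    show "(\<lambda>x. c * f x) \<in> functionals"
      by (rule functionalsI[OF _ _ _ le])
        (simp_all add: functionals_outside[OF f] functionals_add[OF f] functionals_scale[OF f]
            distrib_left mult.left_commute)
    show "dual_norm (\<lambda>x. c * f x) \<le> cmod c * dual_norm f"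
      by (rule dual_norm_le[OF _ le]) (simp_all add: functionals_dual_norm_nonneg f)
  qed
  have zero: "0 \<in> functionals" by (rule functionalsI[of _ 0]) auto
  show ?thesis
  proof
    show "V.subspace functionals" unfolding V.subspace_def using zero add scale by auto
    fix f g c assume f: "f \<in> functionals"
    show "dual_norm f = 0 \<longleftrightarrow> f = 0"
    proof
      assume "dual_norm f = 0"
      then show "f = 0"
        using functionals_apply_le[OF f] functionals_outside[OF f] by (fastforce simp: fun_eq_iff)
    next
      assume "f = 0"
      then have "dual_norm f \<le> 0" by (intro dual_norm_le) auto
      then show "dual_norm f = 0" using functionals_dual_norm_nonneg[OF f] by simp
    qed
    show "dual_norm (\<lambda>x. c * f x) = cmod c * dual_norm f"
    proof (cases "c = 0")
      case True
      then show ?thesis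
        using scale(2)[OF f, of c] functionals_dual_norm_nonneg[OF scale(1)[OF f, of c]] by simp
    next
      case False
      have "dual_norm (\<lambda>x. inverse c * (c * f x)) \<le> cmod (inverse c) * dual_norm (\<lambda>x. c * f x)"
        by (intro scale f)
      moreover have "(\<lambda>x. inverse c * (c * f x)) = f" using False by auto
      ultimately have "cmod c * dual_norm f \<le> dual_norm (\<lambda>x. c * f x)"
        using False by (simp add: norm_inverse norm_divide field_simps)
      then show ?thesis using scale(2)[OF f, of c] by simp
    qed
    assume "g \<in> functionals"
    then show "dual_norm (f + g) \<le> dual_norm f + dual_norm g" using f by (intro add)
  qed
qed

text \<open>Pointwise limits exist on \<open>X\<close> by the Cauchy estimate and off
  \<open>X\<close> because all terms vanish there. Letting one index of the estimate tend to
  infinity gives convergence in norm.\<close>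

lemma complex_banach_on_functionals:
  "complex_banach_on (\<lambda>c f x. c * f x) functionals dual_norm"
proof -
  interpret F: complex_normed_on "\<lambda>c f x. c * f x" functionals dual_norm
    by (rule complex_normed_on_functionals)
  show ?thesis
  proof
    fix \<sigma> :: "nat \<Rightarrow> 'v \<Rightarrow> complex"
    assume \<sigma>: "\<And>n. \<sigma> n \<in> functionals"
      and cauchy: "\<And>e. e > 0 \<Longrightarrow> \<exists>k. \<forall>m\<ge>k. \<forall>n\<ge>k. dual_norm (\<sigma> m - \<sigma> n) < e"
    have le: "cmod (\<sigma> m x - \<sigma> n x) \<le> dual_norm (\<sigma> m - \<sigma> n) * nrm x" if "x \<in> X" for m n x
      using functionals_apply_le[OF F.subspace_diff[OF F.subspace_carrier \<sigma> \<sigma>] that, of m n] by simp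
    have "Cauchy (\<lambda>n. \<sigma> n x)" for x
    proof (cases "x \<in> X")
      case x: True
      show ?thesis
      proof (rule CauchyI)
        fix e :: real assume e: "e > 0"
        have pos: "nrm x + 1 > 0" using nrm_nonneg[OF x] by simp
        then obtain k where k: "dual_norm (\<sigma> m - \<sigma> n) < e / (nrm x + 1)" if "m \<ge> k" "n \<ge> k" for m n
          using cauchy[of "e / (nrm x + 1)"] e by auto
        have "cmod (\<sigma> m x - \<sigma> n x) < e" if "m \<ge> k" "n \<ge> k" for m n
        proof -
          have "dual_norm (\<sigma> m - \<sigma> n) * nrm x \<le> e / (nrm x + 1) * nrm x"
            using k[OF that] nrm_nonneg[OF x] by (intro mult_right_mono) auto
          also have "\<dots> < e" using e pos by (simp add: pos_divide_less_eq distrib_left)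
          finally show ?thesis using le[OF x, of m n] by simp
        qed
        then show "\<exists>M. \<forall>m\<ge>M. \<forall>n\<ge>M. cmod (\<sigma> m x - \<sigma> n x) < e" by blast
      qed
    qed (simp add: functionals_outside[OF \<sigma>] Cauchy_def)
    then obtain f where f: "\<And>x. (\<lambda>n. \<sigma> n x) \<longlonglongrightarrow> f x"
      unfolding Cauchy_convergent_iff convergent_def by metis
    have tail: "\<exists>k. \<forall>m\<ge>k. \<forall>x\<in>X. cmod (\<sigma> m x - f x) \<le> e * nrm x" if "e > 0" for e
    proof -
      obtain k where k: "dual_norm (\<sigma> m - \<sigma> n) < e" if "m \<ge> k" "n \<ge> k" for m n
        using cauchy[OF \<open>e > 0\<close>] by blast
      have "cmod (\<sigma> m x - f x) \<le> e * nrm x" if m: "m \<ge> k" and x: "x \<in> X" for m x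
      proof (rule Lim_bounded)
        show "(\<lambda>n. cmod (\<sigma> m x - \<sigma> n x)) \<longlonglongrightarrow> cmod (\<sigma> m x - f x)"
          by (intro tendsto_intros f)
        show "\<forall>n\<ge>k. cmod (\<sigma> m x - \<sigma> n x) \<le> e * nrm x"
          using le[OF x, of m] k[OF m] nrm_nonneg[OF x]
          by (meson mult_right_mono less_imp_le order_trans)
      qed
      then show ?thesis by blast
    qed
    obtain k where k: "\<And>x. x \<in> X \<Longrightarrow> cmod (\<sigma> k x - f x) \<le> nrm x"
      using tail[of 1] by force
    have mem: "f \<in> functionals"
    proof (rule functionalsI)
      show "f x = 0" if "x \<notin> X" for x
        using f[of x] functionals_outside[OF \<sigma> that] by (simp add: LIMSEQ_const_iff)
      show "f (x + y) = f x + f y" if "x \<in> X" "y \<in> X" for x y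
        using tendsto_add[OF f[of x] f[of y]] f[of "x + y"] functionals_add[OF \<sigma> that]
        by (simp add: LIMSEQ_unique)
      show "f (sc c x) = c * f x" if "x \<in> X" for c x
        using tendsto_mult_left[OF f[of x], of c] f[of "sc c x"] functionals_scale[OF \<sigma> that]
        by (simp add: LIMSEQ_unique)
      show "cmod (f x) \<le> (dual_norm (\<sigma> k) + 1) * nrm x" if "x \<in> X" for x
        using k[OF that] functionals_apply_le[OF \<sigma>[of k] that]
          norm_triangle_ineq4[of "\<sigma> k x" "\<sigma> k x - f x"]
        by (simp add: algebra_simps)
    qed
    have "(\<lambda>n. dual_norm (\<sigma> n - f)) \<longlonglongrightarrow> 0"
    proof (rule LIMSEQ_I)
      fix e :: real assume "e > 0"
      then obtain k where k: "\<And>m x. m \<ge> k \<Longrightarrow> x \<in> X \<Longrightarrow> cmod (\<sigma> m x - f x) \<le> e / 2 * nrm x"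
        using tail[of "e / 2"] by auto
      have "norm (dual_norm (\<sigma> m - f) - 0) < e" if "m \<ge> k" for m
      proof -
        have "dual_norm (\<sigma> m - f) \<le> e / 2"
          using \<open>e > 0\<close> k[OF that] by (intro dual_norm_le) auto
        moreover have "0 \<le> dual_norm (\<sigma> m - f)"
          by (intro functionals_dual_norm_nonneg F.subspace_diff[OF F.subspace_carrier] \<sigma> mem)
        ultimately show ?thesis using \<open>e > 0\<close> by simp
      qed
      then show "\<exists>k. \<forall>m\<ge>k. norm (dual_norm (\<sigma> m - f) - 0) < e" by blast
    qed
    then show "\<exists>f\<in>functionals. (\<lambda>n. dual_norm (\<sigma> n - f)) \<longlonglongrightarrow> 0" using mem by blast
  qed
qed

text \<open>The carrier has a norm but its type has no topology, so closure is expressed by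
  approximation.\<close>

definition closure_on :: "'v set \<Rightarrow> 'v set" where
  "closure_on S = {x \<in> X. \<forall>e>0. \<exists>y\<in>S. nrm (x - y) < e}"

lemma closure_on_subset: "S \<subseteq> X \<Longrightarrow> S \<subseteq> closure_on S"
  unfolding closure_on_def using nrm_zero by (auto intro!: bexI simp: subset_iff)

lemma closure_on_closed:
  assumes S: "S \<subseteq> X" and x: "x \<in> X" and "\<And>e. e > 0 \<Longrightarrow> \<exists>y\<in>closure_on S. nrm (x - y) < e"
  shows "x \<in> closure_on S"
  unfolding closure_on_def
proof (intro CollectI conjI x allI impI)
  fix e :: real assume "e > 0"
  then obtain y where y: "y \<in> closure_on S" "nrm (x - y) < e / 2" using assms(3)[of "e / 2"] by auto
  have "\<exists>z\<in>S. nrm (y - z) < e / 2"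
    using y(1) half_gt_zero[OF \<open>e > 0\<close>] unfolding closure_on_def by blast
  then obtain z where z: "z \<in> S" "nrm (y - z) < e / 2" by blast
  have "nrm (x - z) \<le> nrm (x - y) + nrm (y - z)"
    using x y z S by (intro nrm_diff_triangle) (auto simp: closure_on_def)
  then show "\<exists>y\<in>S. nrm (x - y) < e" using y z by force
qed

lemma subspace_closure_on:
  assumes S: "subspace S" "S \<subseteq> X"
  shows "subspace (closure_on S)"
proof (rule subspaceI)
  have cX: "x \<in> X" if "x \<in> closure_on S" for x using that by (simp add: closure_on_def)
  have ex: "\<exists>y\<in>S. nrm (x - y) < e" if "x \<in> closure_on S" "e > 0" for x e
    using that by (simp add: closure_on_def)
  show "0 \<in> closure_on S"
    using closure_on_subset[OF S(2)] subspace_0[OF S(1)] by blast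
  fix x assume x: "x \<in> closure_on S"
  show "sc c x \<in> closure_on S" for c
    unfolding closure_on_def
  proof (intro CollectI conjI allI impI)
    show "sc c x \<in> X" using subspace_carrier cX[OF x] by (rule subspace_scale)
    fix e :: real assume "e > 0"
    then obtain y where y: "y \<in> S" "nrm (x - y) < e / (cmod c + 1)"
      using ex[OF x, of "e / (cmod c + 1)"] by (auto simp: add_nonneg_pos)
    have xy: "x - y \<in> X" using subspace_carrier cX[OF x] y S by (intro subspace_diff) auto
    have "nrm (sc c x - sc c y) = cmod c * nrm (x - y)"
      using nrm_sc[OF xy, of c] by (simp add: scale_right_diff_distrib)
    also have "\<dots> \<le> cmod c * (e / (cmod c + 1))" using y by (intro mult_left_mono) auto
    also have "\<dots> < e" using \<open>e > 0\<close> by (simp add: pos_divide_less_eq add_nonneg_pos distrib_left)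
    finally show "\<exists>y\<in>S. nrm (sc c x - y) < e"
      using subspace_scale[OF S(1) y(1)] by blast
  qed
  fix y assume y: "y \<in> closure_on S"
  show "x + y \<in> closure_on S"
    unfolding closure_on_def
  proof (intro CollectI conjI allI impI)
    show "x + y \<in> X" using subspace_carrier cX[OF x] cX[OF y] by (rule subspace_add)
    fix e :: real assume "e > 0"
    then obtain u v where uv: "u \<in> S" "nrm (x - u) < e / 2" "v \<in> S" "nrm (y - v) < e / 2"
      using ex[OF x, of "e / 2"] ex[OF y, of "e / 2"] by auto
    have "nrm ((x - u) + (y - v)) \<le> nrm (x - u) + nrm (y - v)"
      using uv S cX[OF x] cX[OF y] by (intro nrm_triangle subspace_diff[OF subspace_carrier]) auto
    then have "nrm (x + y - (u + v)) < e" using uv by (simp add: algebra_simps)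
    then show "\<exists>z\<in>S. nrm (x + y - z) < e" using subspace_add[OF S(1) uv(1,3)] by blast
  qed
qed

end

lemma (in complex_banach_on) complex_banach_on_closure_on:
  assumes S: "subspace S" "S \<subseteq> X"
  shows "complex_banach_on sc (closure_on S) nrm"
proof
  have sub: "closure_on S \<subseteq> X" by (auto simp: closure_on_def)
  show "subspace (closure_on S)" using S by (rule subspace_closure_on)
  show "nrm x = 0 \<longleftrightarrow> x = 0" if "x \<in> closure_on S" for x
    using nrm_eq_0 that sub by blast
  show "nrm (x + y) \<le> nrm x + nrm y" if "x \<in> closure_on S" "y \<in> closure_on S" for x y
    using nrm_triangle that sub by blast
  show "nrm (sc c x) = cmod c * nrm x" if "x \<in> closure_on S" for c x
    using nrm_sc that sub by blast
  fix \<sigma> :: "nat \<Rightarrow> 'v"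
  assume \<sigma>: "\<And>n. \<sigma> n \<in> closure_on S"
    and cauchy: "\<And>e. e > 0 \<Longrightarrow> \<exists>k. \<forall>m\<ge>k. \<forall>n\<ge>k. nrm (\<sigma> m - \<sigma> n) < e"
  have \<sigma>X: "\<And>n. \<sigma> n \<in> X" using \<sigma> sub by blast
  obtain x where x: "x \<in> X" "(\<lambda>n. nrm (\<sigma> n - x)) \<longlonglongrightarrow> 0"
    using complete[OF \<sigma>X cauchy] by blast
  have "\<exists>y\<in>closure_on S. nrm (x - y) < e" if "e > 0" for e
  proof -
    have "\<forall>\<^sub>F n in sequentially. nrm (\<sigma> n - x) < e" using x(2) that by (rule order_tendstoD)
    then obtain n where "nrm (\<sigma> n - x) < e" by (auto dest: eventually_happens)
    then have "nrm (x - \<sigma> n) < e" using nrm_diff_commute[OF \<sigma>X x(1)] by simp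
    then show ?thesis using \<sigma> by blast
  qed
  then have "x \<in> closure_on S" by (rule closure_on_closed[OF S(2) x(1)])
  then show "\<exists>x\<in>closure_on S. (\<lambda>n. nrm (\<sigma> n - x)) \<longlonglongrightarrow> 0" using x(2) by blast
qed

section \<open>Weak* continuous functionals\<close>

text \<open>Induction on the number of functionals. If some \<open>x0\<close> is killed by every
  \<open>g i\<close> with \<open>i \<in> I\<close> but not by \<open>g j\<close>, subtracting the
  multiple of \<open>g j\<close> that agrees with \<open>f\<close> at \<open>x0\<close> reduces the
  claim to \<open>I\<close>. If there is no such point, \<open>g j\<close> vanishes where the others
  do, and the kernel condition already holds for \<open>I\<close>.\<close>

lemma (in vector_space) functional_combination_if_kernels:
  fixes f :: "'b \<Rightarrow> 'a"
  assumes X: "subspace X" and "finite I"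
    and add: "\<And>i x y. i \<in> I \<Longrightarrow> x \<in> X \<Longrightarrow> y \<in> X \<Longrightarrow> g i (x + y) = g i x + g i y"
    and scale: "\<And>i c x. i \<in> I \<Longrightarrow> x \<in> X \<Longrightarrow> g i (scale c x) = c * g i x"
    and f: "\<And>x y. x \<in> X \<Longrightarrow> y \<in> X \<Longrightarrow> f (x + y) = f x + f y"
      "\<And>c x. x \<in> X \<Longrightarrow> f (scale c x) = c * f x"
    and ker: "\<And>x. x \<in> X \<Longrightarrow> (\<And>i. i \<in> I \<Longrightarrow> g i x = 0) \<Longrightarrow> f x = 0"
  shows "\<exists>c. \<forall>x\<in>X. f x = (\<Sum>i\<in>I. c i * g i x)"
  using \<open>finite I\<close> add scale f ker
proof (induction I arbitrary: f rule: finite_induct)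
  case empty
  then show ?case by simp
next
  case (insert j I)
  show ?case
  proof (cases "\<exists>x0\<in>X. (\<forall>i\<in>I. g i x0 = 0) \<and> g j x0 \<noteq> 0")
    case True
    then obtain x0 where x0: "x0 \<in> X" "\<And>i. i \<in> I \<Longrightarrow> g i x0 = 0" "g j x0 \<noteq> 0" by blast
    define d where "d = f x0 / g j x0"
    have "\<exists>c. \<forall>x\<in>X. f x - d * g j x = (\<Sum>i\<in>I. c i * g i x)"
    proof (rule insert.IH)
      fix x assume x: "x \<in> X" and gx: "\<And>i. i \<in> I \<Longrightarrow> g i x = 0"
      \<comment> \<open>Chosen so that \<open>g j\<close> vanishes at \<open>x + scale t x0\<close>;
        the other functionals do not notice the shift.\<close>
      define t where "t = - (g j x / g j x0)"
      have tx: "scale t x0 \<in> X" using X x0(1) by (rule subspace_scale)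
      have "f (x + scale t x0) = 0"
      proof (rule insert.prems(5))
        show "x + scale t x0 \<in> X" using X x tx by (rule subspace_add)
        fix i assume i: "i \<in> insert j I"
        have "g i (x + scale t x0) = g i x + t * g i x0"
          using insert.prems(1)[OF i x tx] insert.prems(2)[OF i x0(1)] by simp
        then show "g i (x + scale t x0) = 0"
          using i gx x0 by (auto simp: t_def)
      qed
      then have "f x + t * f x0 = 0"
        using insert.prems(3)[OF x tx] insert.prems(4)[OF x0(1)] by simp
      then show "f x - d * g j x = 0" by (simp add: t_def d_def)
    qed (use insert.prems in \<open>simp_all add: algebra_simps\<close>)
    then obtain c where c: "\<forall>x\<in>X. f x - d * g j x = (\<Sum>i\<in>I. c i * g i x)" by blast
    have "f x = (\<Sum>i\<in>insert j I. (c(j := d)) i * g i x)" if "x \<in> X" for x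
    proof -
      have "(\<Sum>i\<in>I. (c(j := d)) i * g i x) = (\<Sum>i\<in>I. c i * g i x)"
        using insert.hyps by (intro sum.cong) auto
      then show ?thesis using c that insert.hyps by (simp add: algebra_simps)
    qed
    then show ?thesis by blast
  next
    case False
    have "\<exists>c. \<forall>x\<in>X. f x = (\<Sum>i\<in>I. c i * g i x)"
    proof (rule insert.IH)
      show "f x = 0" if "x \<in> X" "\<And>i. i \<in> I \<Longrightarrow> g i x = 0" for x
        by (rule insert.prems(5)[OF that(1)]) (use False that in auto)
    qed (use insert.prems in auto)
    then obtain c where c: "\<forall>x\<in>X. f x = (\<Sum>i\<in>I. c i * g i x)" by blast
    have "f x = (\<Sum>i\<in>insert j I. (c(j := 0)) i * g i x)" if "x \<in> X" for x
    proof -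
      have "(\<Sum>i\<in>I. (c(j := 0)) i * g i x) = (\<Sum>i\<in>I. c i * g i x)"
        using insert.hyps by (intro sum.cong) auto
      then show ?thesis using c that insert.hyps by simp
    qed
    then show ?thesis by blast
  qed
qed

section \<open>Weak* continuity and pre-adjoints\<close>

lemma topspace_weak_star_topology:
  "topspace (weak_star_topology X E \<Phi>) = {x \<in> X. \<Phi> x \<in> extensional E}"
  by (auto simp: weak_star_topology_def topspace_pullback_topology PiE_def)

lemma continuous_map_weak_star_eval:
  assumes "e \<in> E"
  shows "continuous_map (weak_star_topology X E \<Phi>) euclidean (\<lambda>x. \<Phi> x e)"
proof -
  have "continuous_map (product_topology (\<lambda>_. euclidean) E) euclidean (\<lambda>f :: _ \<Rightarrow> complex. f e)"
    using continuous_map_product_projection[OF assms, of "\<lambda>_. euclidean"] by simp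
  from continuous_map_pullback[OF this, of X \<Phi>] show ?thesis
    by (simp add: weak_star_topology_def comp_def)
qed

text \<open>Continuity into the weak* topology is tested on coordinates, and by \<open>adj\<close>
  composition with \<open>T\<close> turns coordinates into coordinates: \<open>e'\<close> is the
  value at \<open>e\<close> of a pre-adjoint of \<open>T\<close>.\<close>

lemma continuous_map_weak_starI:
  assumes ext: "\<And>x. x \<in> X \<Longrightarrow> \<Phi> x \<in> extensional E" and T: "\<And>x. x \<in> X \<Longrightarrow> T x \<in> X"
    and adj: "\<And>e. e \<in> E \<Longrightarrow> \<exists>e'\<in>E. \<forall>x\<in>X. \<Phi> (T x) e = \<Phi> x e'"
  shows "continuous_map (weak_star_topology X E \<Phi>) (weak_star_topology X E \<Phi>) T"
proof -
  have "continuous_map (weak_star_topology X E \<Phi>) euclidean (\<lambda>x. \<Phi> (T x) e)" if e: "e \<in> E" for e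
  proof -
    obtain e' where e': "e' \<in> E" "\<And>x. x \<in> X \<Longrightarrow> \<Phi> (T x) e = \<Phi> x e'" using adj[OF e] by blast
    show ?thesis
      by (rule continuous_map_eq[OF continuous_map_weak_star_eval[OF e'(1)]])
        (simp add: topspace_weak_star_topology e'(2))
  qed
  then have "continuous_map (weak_star_topology X E \<Phi>) (product_topology (\<lambda>_. euclidean) E) (\<Phi> \<circ> T)"
    using ext T by (auto simp: continuous_map_componentwise topspace_weak_star_topology)
  then show ?thesis
    unfolding weak_star_topology_def[of X E \<Phi>] using T
    by (intro continuous_map_pullback') (auto simp: topspace_pullback_topology)
qed

context dual_banach_algebra
begin

lemma dual_mem: "x \<in> X \<Longrightarrow> \<Phi> x \<in> predual.dual"
  using bij_dual by (auto simp: bij_betw_def)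

lemma ext_dual: "x \<in> X \<Longrightarrow> \<Phi> x \<in> extensional E"
  using dual_mem by (auto simp: predual.dual_def)

lemma zero_dual: "e \<in> E \<Longrightarrow> \<Phi> 0 e = 0"
  using sc_dual[of 0 e 0] subspace_0[OF subspace_carrier] by simp

lemma predual_add: "x \<in> X \<Longrightarrow> e \<in> E \<Longrightarrow> e' \<in> E \<Longrightarrow> \<Phi> x (e + e') = \<Phi> x e + \<Phi> x e'"
  and predual_sc: "x \<in> X \<Longrightarrow> e \<in> E \<Longrightarrow> \<Phi> x (scE c e) = c * \<Phi> x e"
  using dual_mem by (auto simp: predual.dual_def)

text \<open>A basic neighbourhood of 0 restricts only finitely many coordinates. On their common
  kernel, a subspace, \<open>f\<close> is bounded and therefore zero, so \<open>f\<close> is a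
  linear combination of these coordinates.\<close>

lemma weak_star_continuous_functional:
  assumes add: "\<And>x y. x \<in> X \<Longrightarrow> y \<in> X \<Longrightarrow> f (x + y) = f x + f y"
    and sc: "\<And>c x. x \<in> X \<Longrightarrow> f (sc c x) = c * f x"
    and cont: "continuous_map (weak_star_topology X E \<Phi>) euclidean f"
  shows "\<exists>e\<in>E. \<forall>x\<in>X. f x = \<Phi> x e"
proof -
  have "openin (weak_star_topology X E \<Phi>) {x \<in> topspace (weak_star_topology X E \<Phi>). f x \<in> ball 0 1}"
    using cont by (rule openin_continuous_map_preimage) simp
  then obtain V where V: "openin (product_topology (\<lambda>_. euclidean) E) V"
    "{x \<in> X. f x \<in> ball 0 1} = \<Phi> -` V \<inter> X"
    unfolding weak_star_topology_def openin_pullback_topology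
    by (fold weak_star_topology_def) (auto simp: topspace_weak_star_topology ext_dual cong: conj_cong)
  have 0: "0 \<in> X" using subspace_carrier by (rule subspace_0)
  have "f 0 = 0" using sc[OF 0, of 0] by simp
  then have "\<Phi> 0 \<in> V" using V(2) 0 by auto
  then obtain U where U: "finite {i \<in> E. U i \<noteq> UNIV}" "\<Phi> 0 \<in> Pi\<^sub>E E U" "Pi\<^sub>E E U \<subseteq> V"
    using V(1) unfolding openin_product_topology_alt by (auto simp: fun_eq_iff)
  define I where "I = {i \<in> E. U i \<noteq> UNIV}"
  have small: "cmod (f x) < 1" if x: "x \<in> X" and ker: "\<And>i. i \<in> I \<Longrightarrow> \<Phi> x i = 0" for x
  proof -
    have "\<Phi> x i \<in> U i" if "i \<in> E" for i
    proof (cases "U i = UNIV")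
      case False
      then have "\<Phi> x i = \<Phi> 0 i" using ker[of i] that zero_dual by (simp add: I_def)
      then show ?thesis using U(2) that by auto
    qed simp
    then have "\<Phi> x \<in> Pi\<^sub>E E U" using ext_dual[OF x] by (simp add: PiE_def)
    then have "x \<in> \<Phi> -` V \<inter> X" using U(3) x by auto
    then have "x \<in> {x \<in> X. f x \<in> ball 0 1}" by (simp only: V(2))
    then show ?thesis by simp
  qed
  have ker: "f x = 0" if x: "x \<in> X" and ker: "\<And>i. i \<in> I \<Longrightarrow> \<Phi> x i = 0" for x
  proof (rule ccontr)
    assume "f x \<noteq> 0"
    \<comment> \<open>The scaled point stays in the common kernel, yet \<open>f\<close> has the
      value 1 there.\<close>
    moreover have "cmod (f (sc (inverse (f x)) x)) < 1"
      using ker x by (intro small subspace_scale[OF subspace_carrier]) (auto simp: I_def sc_dual)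
    ultimately show False using sc[OF x] by simp
  qed
  have "finite I" using U(1) by (simp add: I_def)
  have "\<exists>c. \<forall>x\<in>X. f x = (\<Sum>i\<in>I. c i * \<Phi> x i)"
    using ker
    by (intro functional_combination_if_kernels[OF subspace_carrier \<open>finite I\<close>])
      (auto simp: I_def add_dual sc_dual add sc)
  then obtain c where c: "\<And>x. x \<in> X \<Longrightarrow> f x = (\<Sum>i\<in>I. c i * \<Phi> x i)" by blast
  have "(\<Sum>i\<in>J. scE (c i) i) \<in> E \<and> \<Phi> x (\<Sum>i\<in>J. scE (c i) i) = (\<Sum>i\<in>J. c i * \<Phi> x i)"
    if "J \<subseteq> I" "x \<in> X" for J x
  proof -
    have "finite J" using that \<open>finite I\<close> by (auto intro: finite_subset)
    then show ?thesis using that(1)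
    proof (induction J rule: finite_induct)
      case empty
      have "\<Phi> x (scE 0 0) = 0"
        using predual_sc[OF that(2) predual.subspace_0[OF predual.subspace_carrier], of 0] by simp
      then show ?case by (simp add: predual.subspace_0[OF predual.subspace_carrier])
    next
      case (insert j J)
      then have "j \<in> E" by (simp add: I_def)
      then have "scE (c j) j \<in> E" by (rule predual.subspace_scale[OF predual.subspace_carrier])
      with insert show ?case
        using \<open>j \<in> E\<close> that(2) predual.subspace_add[OF predual.subspace_carrier]
        by (simp add: predual_add predual_sc)
    qed
  qed
  then show ?thesis using c 0 by (intro bexI[of _ "\<Sum>i\<in>I. scE (c i) i"]) auto
qed

text \<open>By separate weak* continuity the left-hand side is a weak* continuous functional of
  \<open>y\<close>, hence evaluation at a point of \<open>E\<close>. This is the origin of the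
  module action on the predual.\<close>

lemma preadjoint_left:
  assumes x: "x \<in> X" and e: "e \<in> E"
  shows "\<exists>e'\<in>E. \<forall>y\<in>X. \<Phi> (mul x y) e = \<Phi> y e'"
proof (rule weak_star_continuous_functional)
  show "continuous_map (weak_star_topology X E \<Phi>) euclidean (\<lambda>y. \<Phi> (mul x y) e)"
    using continuous_map_compose[OF weak_star_left[OF x] continuous_map_weak_star_eval[OF e]]
    by (simp add: comp_def)
qed (simp_all add: x e mul_add_right mul_sc_right mul_closed add_dual sc_dual)

lemma preadjoint_right:
  assumes x: "x \<in> X" and e: "e \<in> E"
  shows "\<exists>e'\<in>E. \<forall>y\<in>X. \<Phi> (mul y x) e = \<Phi> y e'"
proof (rule weak_star_continuous_functional)
  show "continuous_map (weak_star_topology X E \<Phi>) euclidean (\<lambda>y. \<Phi> (mul y x) e)"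
    using continuous_map_compose[OF weak_star_right[OF x] continuous_map_weak_star_eval[OF e]]
    by (simp add: comp_def)
qed (simp_all add: x e mul_add_left mul_sc_left mul_closed add_dual sc_dual)

end

section \<open>A criterion for preduals of Banach algebras\<close>

context complex_banach_algebra_on
begin

interpretation F: complex_banach_on "\<lambda>c f x. c * f x" functionals dual_norm
  by (rule complex_banach_on_functionals)

text \<open>Every property of the candidate predual is tested on \<open>G\<close> alone:
  \<open>norming\<close> gives injectivity and the lower norm estimate, \<open>repr\<close> gives
  surjectivity, \<open>left\<close> and \<open>right\<close> give pre-adjoints of the
  multiplications. Linearity and boundedness carry all of this to the closed span.\<close>

lemma dual_banach_algebra_if_generators:
  fixes G
  defines "E \<equiv> F.closure_on (F.span G)"
  assumes G: "G \<subseteq> functionals"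
    and norming: "\<And>x K. x \<in> X \<Longrightarrow> 0 \<le> K \<Longrightarrow> (\<And>g. g \<in> G \<Longrightarrow> cmod (g x) \<le> K * dual_norm g)
      \<Longrightarrow> nrm x \<le> K"
    and repr: "\<And>\<phi>. \<phi> \<in> complex_normed_on.dual (\<lambda>c f x. c * f x) E dual_norm
      \<Longrightarrow> \<exists>x\<in>X. \<forall>g\<in>G. \<phi> g = g x"
    and left: "\<And>x g. x \<in> X \<Longrightarrow> g \<in> G \<Longrightarrow> (\<lambda>y. if y \<in> X then g (mul x y) else 0) \<in> E"
    and right: "\<And>x g. x \<in> X \<Longrightarrow> g \<in> G \<Longrightarrow> (\<lambda>y. if y \<in> X then g (mul y x) else 0) \<in> E"
  shows "dual_banach_algebra sc X nrm mul (\<lambda>c f x. c * f x) E dual_norm (\<lambda>x. \<lambda>f\<in>E. f x)"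
proof -
  have span: "F.span G \<subseteq> functionals"
    by (rule F.span_minimal[OF G F.subspace_carrier])
  interpret predual: complex_banach_on "\<lambda>c f x. c * f x" E dual_norm
    unfolding E_def by (rule F.complex_banach_on_closure_on[OF F.subspace_span span])
  have E: "E \<subseteq> functionals" by (auto simp: E_def F.closure_on_def)
  have GE: "g \<in> E" if "g \<in> G" for g
    using F.closure_on_subset[OF span] F.span_base[OF that] by (auto simp: E_def)
  have approx: "\<exists>g\<in>F.span G. dual_norm (f - g) < e" if "f \<in> E" "e > 0" for f e
    using that by (auto simp: E_def F.closure_on_def)
  have spanE: "F.span G \<subseteq> E" unfolding E_def by (rule F.closure_on_subset[OF span])
  let ?\<Phi> = "\<lambda>x. \<lambda>f\<in>E. f x"
  have mem: "?\<Phi> x \<in> predual.dual" if x: "x \<in> X" for x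
    unfolding predual.dual_def
  proof (intro CollectI conjI ballI allI exI)
    show "cmod (?\<Phi> x f) \<le> nrm x * dual_norm f" if "f \<in> E" for f
      using functionals_apply_le[of f x] that x E by (auto simp: mult.commute)
    show "?\<Phi> x (f + g) = ?\<Phi> x f + ?\<Phi> x g" if "f \<in> E" "g \<in> E" for f g
      using that F.subspace_add[OF predual.subspace_carrier] by simp
    show "?\<Phi> x (\<lambda>y. c * f y) = c * ?\<Phi> x f" if "f \<in> E" for f c
      using that F.subspace_scale[OF predual.subspace_carrier] by simp
  qed simp
  have inj: "x = y" if xy: "x \<in> X" "y \<in> X" and eq: "?\<Phi> x = ?\<Phi> y" for x y
  proof -
    have d: "x - y \<in> X" using subspace_carrier xy by (rule subspace_diff)
    have "g (x - y) = 0" if g: "g \<in> G" for g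
    proof -
      have "g x = g y" using eq GE[OF g] by (metis restrict_apply')
      moreover have "g x = g (x - y) + g y"
        using functionals_add[of g "x - y" y] g G d xy by auto
      ultimately show ?thesis by simp
    qed
    \<comment> \<open>This is \<open>norming\<close> with \<open>K = 0\<close>.\<close>
    then have "nrm (x - y) \<le> 0" by (intro norming d) auto
    then show ?thesis using nrm_nonneg[OF d] nrm_eq_0[OF d] by simp
  qed
  have surj: "\<exists>x\<in>X. \<phi> = ?\<Phi> x" if \<phi>: "\<phi> \<in> predual.dual" for \<phi>
  proof -
    obtain x where x: "x \<in> X" "\<And>g. g \<in> G \<Longrightarrow> \<phi> g = g x"
      using repr \<phi> by blast
    have add: "\<phi> (f + g) = \<phi> f + \<phi> g" if "f \<in> E" "g \<in> E" for f g
      using \<phi> that by (simp add: predual.dual_def)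
    have scale: "\<phi> (\<lambda>y. c * f y) = c * \<phi> f" if "f \<in> E" for f c
      using \<phi> that by (simp add: predual.dual_def)
    have "\<phi> f = f x \<and> f \<in> E" if "f \<in> F.span G" for f
      using that
    proof (induction rule: F.span_induct_alt)
      case base
      have "0 \<in> E" using F.subspace_0[OF predual.subspace_carrier] .
      then show ?case using scale[of 0 0] by (simp add: zero_fun_def)
    next
      case (step c g f)
      have "(\<lambda>y. c * g y) \<in> E"
        using GE[OF step(1)] by (rule F.subspace_scale[OF predual.subspace_carrier])
      then have "\<phi> ((\<lambda>y. c * g y) + f) = c * \<phi> g + \<phi> f" "(\<lambda>y. c * g y) + f \<in> E"
        using step(2) by (simp_all only: add scale[OF GE[OF step(1)]]
            F.subspace_add[OF predual.subspace_carrier])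
      then show ?case using step x(2) by (simp only:) simp
    qed
    then have span_eq: "\<phi> g = g x" if "g \<in> F.span G" for g using that by blast
    have "\<phi> f = f x" if f: "f \<in> E" for f
    proof -
      \<comment> \<open>\<phi> and evaluation at \<open>x\<close> agree on the span, so at
        \<open>f\<close> they differ by at most \<open>D\<close> times the distance to the span;
        since \<open>D\<close> may be 0, the division below is by \<open>D + 1\<close>.\<close>
      define D where "D = predual.dual_norm \<phi> + nrm x"
      have "cmod (\<phi> f - f x) \<le> 0 + e" if e: "e > 0" for e
      proof -
        have D: "D + 1 > 0"
          using nrm_nonneg[OF x(1)] predual.dual_norm_nonneg[of \<phi>] \<phi>
          unfolding D_def predual.dual_def by force
        then obtain g where g: "g \<in> F.span G" "dual_norm (f - g) < e / (D + 1)"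
          using approx[OF f, of "e / (D + 1)"] e by auto
        have gE: "g \<in> E" using g spanE by blast
        have fg: "f - g \<in> E" using f gE by (rule F.subspace_diff[OF predual.subspace_carrier])
        have "\<phi> f - f x = \<phi> (f - g) - (f - g) x"
          using add[OF fg gE] span_eq[OF g(1)] by simp
        also have "cmod \<dots> \<le> cmod (\<phi> (f - g)) + cmod ((f - g) x)" by (rule norm_triangle_ineq4)
        also have "\<dots> \<le> predual.dual_norm \<phi> * dual_norm (f - g) + dual_norm (f - g) * nrm x"
          using fg E x by (intro add_mono predual.dual_apply_le \<phi> functionals_apply_le) blast+
        also have "\<dots> = D * dual_norm (f - g)" by (simp add: D_def algebra_simps)
        also have "\<dots> \<le> (D + 1) * dual_norm (f - g)"
          using predual.nrm_nonneg[OF fg] by (simp add: distrib_right)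
        also have "\<dots> \<le> (D + 1) * (e / (D + 1))" using D g(2) by (intro mult_left_mono) auto
        also have "\<dots> = e" using D by simp
        finally show ?thesis by simp
      qed
      then have "cmod (\<phi> f - f x) \<le> 0" by (rule field_le_epsilon)
      then show ?thesis by simp
    qed
    moreover have "\<phi> \<in> extensional E" using \<phi> by (simp add: predual.dual_def)
    ultimately have "\<phi> = ?\<Phi> x" by (intro extensionalityI[of _ E]) auto
    then show ?thesis using x(1) by blast
  qed
  \<comment> \<open>Precomposition with a bounded operator \<open>T\<close> preserves
    \<open>E\<close> as soon as it sends the generators into \<open>E\<close>, so it acts as a
    pre-adjoint of \<open>T\<close>.\<close>
  have precompose: "\<exists>f'\<in>E. \<forall>x\<in>X. ?\<Phi> (T x) f = ?\<Phi> x f'"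
    if T: "\<And>x. x \<in> X \<Longrightarrow> T x \<in> X" "\<And>x y. x \<in> X \<Longrightarrow> y \<in> X \<Longrightarrow> T (x + y) = T x + T y"
      "\<And>c x. x \<in> X \<Longrightarrow> T (sc c x) = sc c (T x)" "\<And>x. x \<in> X \<Longrightarrow> nrm (T x) \<le> C * nrm x"
      and C: "0 \<le> C"
      and gen: "\<And>g. g \<in> G \<Longrightarrow> (\<lambda>y. if y \<in> X then g (T y) else 0) \<in> E" and f: "f \<in> E" for T C f
  proof -
    \<comment> \<open>The cut-off outside \<open>X\<close> is what membership in
      \<open>functionals\<close> demands.\<close>
    define P where "P f = (\<lambda>y. if y \<in> X then f (T y) else 0)" for f :: "'v \<Rightarrow> complex"
    have P_le: "cmod (P f x) \<le> (C * dual_norm f) * nrm x" if "f \<in> functionals" "x \<in> X" for f x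
    proof -
      have "cmod (f (T x)) \<le> dual_norm f * nrm (T x)" by (intro functionals_apply_le that T)
      also have "\<dots> \<le> dual_norm f * (C * nrm x)"
        by (intro mult_left_mono T functionals_dual_norm_nonneg that)
      finally show ?thesis using that by (simp add: P_def ac_simps)
    qed
    have P_functionals: "P f \<in> functionals" if f: "f \<in> functionals" for f
      by (rule functionalsI[OF _ _ _ P_le[OF f]])
        (simp_all add: P_def T subspace_add[OF subspace_carrier] subspace_scale[OF subspace_carrier]
          functionals_add[OF f] functionals_scale[OF f])
    have P_norm: "dual_norm (P f) \<le> C * dual_norm f" if f: "f \<in> functionals" for f
      using C functionals_dual_norm_nonneg[OF f] by (intro dual_norm_le P_le f) simp
    have P_span: "P f \<in> E" if "f \<in> F.span G" for f
      using that
    proof (induction rule: F.span_induct_alt)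
      case base
      have "P 0 = 0" by (simp add: P_def fun_eq_iff)
      then show ?case using F.subspace_0[OF predual.subspace_carrier] by (simp only:)
    next
      case (step c g f)
      have eq: "P ((\<lambda>x. c * g x) + f) = (\<lambda>x. c * P g x) + P f" by (simp add: P_def fun_eq_iff)
      have "(\<lambda>x. c * P g x) \<in> E"
        using gen[OF step(1)] unfolding P_def
        by (rule F.subspace_scale[OF predual.subspace_carrier])
      then show ?case
        unfolding eq using step(2) by (rule F.subspace_add[OF predual.subspace_carrier])
    qed
    have "P f \<in> E"
      unfolding E_def
    proof (rule F.closure_on_closed[OF span])
      show "P f \<in> functionals" using f E by (blast intro: P_functionals)
      fix e :: real assume e: "e > 0"
      then obtain g where g: "g \<in> F.span G" "dual_norm (f - g) < e / (C + 1)"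
        using approx[OF f, of "e / (C + 1)"] C by auto
      have fg: "f - g \<in> functionals"
        using f g(1) span E by (intro F.subspace_diff[OF F.subspace_carrier]) auto
      have "P f - P g = P (f - g)" by (simp add: P_def fun_eq_iff)
      then have "dual_norm (P f - P g) \<le> C * dual_norm (f - g)" using P_norm[OF fg] by simp
      also have "\<dots> \<le> C * (e / (C + 1))" using C g(2) by (intro mult_left_mono) auto
      also have "\<dots> < e" using C e by (simp add: pos_divide_less_eq distrib_left)
      finally show "\<exists>h\<in>F.closure_on (F.span G). dual_norm (P f - h) < e"
        using P_span[OF g(1)] unfolding E_def by blast
    qed
    then show ?thesis using f T by (intro bexI[of _ "P f"]) (auto simp: P_def)
  qed
  show ?thesis
  proof
    show "bij_betw ?\<Phi> X predual.dual"
      using mem inj surj unfolding bij_betw_def inj_on_def by (blast intro!: equalityI)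
    fix x assume x: "x \<in> X"
    show "?\<Phi> (x + y) f = ?\<Phi> x f + ?\<Phi> y f" if "y \<in> X" "f \<in> E" for y f
      using that x E by (auto intro: functionals_add)
    show "?\<Phi> (sc c x) f = c * ?\<Phi> x f" if "f \<in> E" for c f
      using that x E by (auto intro: functionals_scale)
    show "predual.dual_norm (?\<Phi> x) = nrm x"
    proof (rule antisym)
      show "predual.dual_norm (?\<Phi> x) \<le> nrm x"
        using x E functionals_apply_le
        by (intro predual.dual_norm_le) (auto simp: nrm_nonneg mult.commute)
      have le: "cmod (g x) \<le> predual.dual_norm (?\<Phi> x) * dual_norm g" if "g \<in> E" for g
        using predual.dual_apply_le[OF mem[OF x] that] that by simp
      have "0 \<le> predual.dual_norm (?\<Phi> x)"
        using mem[OF x] unfolding predual.dual_def by (blast intro: predual.dual_norm_nonneg)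
      then show "nrm x \<le> predual.dual_norm (?\<Phi> x)"
        using x le GE by (intro norming) auto
    qed
    show "continuous_map (weak_star_topology X E ?\<Phi>) (weak_star_topology X E ?\<Phi>) (\<lambda>y. mul x y)"
      by (rule continuous_map_weak_starI, simp, simp add: mul_closed x,
          rule precompose[where C = "nrm x"])
        (simp_all add: x mul_closed mul_add_right mul_sc_right nrm_mul left nrm_nonneg)
    show "continuous_map (weak_star_topology X E ?\<Phi>) (weak_star_topology X E ?\<Phi>) (\<lambda>y. mul y x)"
      by (rule continuous_map_weak_starI, simp, simp add: mul_closed x,
          rule precompose[where C = "nrm x"])
        (simp_all add: x mul_closed mul_add_left mul_sc_left nrm_mul right nrm_nonneg
          mult.commute[of "nrm x"])
  qed
qed

end

section \<open>The predual of the multiplier algebra\<close>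

locale dual_algebra_embedding =
  fixes \<iota> :: "'a::complex_banach_algebra \<Rightarrow> 'b::complex_banach_algebra"
    and \<Psi> :: "'b \<Rightarrow> 'p::complex_banach_space \<Rightarrow> complex"
  assumes faithful: "faithful_algebra TYPE('a)"
    and dense: "closure (module.span scaleC {a * b | a b :: 'a. True}) = UNIV"
    and dual: "dual_banach_algebra scaleC (UNIV :: 'b set) norm (*)
                 scaleC (UNIV :: 'p set) norm \<Psi>"
    and hom: "isometric_hom \<iota>"
    and ideal: "algebra_ideal (range \<iota>)"
    and injective: "inj (induced_multiplier \<iota>)"
begin

section \<open>The ideal inside the ambient dual Banach algebra\<close>

interpretation D: dual_banach_algebra scaleC "UNIV :: 'b set" norm "(*)"
    scaleC "UNIV :: 'p set" norm \<Psi>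
  by (rule dual)

lemma iota_add: "\<iota> (x + y) = \<iota> x + \<iota> y" and iota_scaleC: "\<iota> (scaleC c x) = scaleC c (\<iota> x)"
  and iota_mult: "\<iota> (x * y) = \<iota> x * \<iota> y" and norm_iota: "norm (\<iota> x) = norm x"
  using hom by (auto simp: isometric_hom_def)

lemma bounded_linear_iota: "bounded_linear \<iota>"
  by (rule bounded_linear_intro[of _ 1])
    (simp_all add: iota_add norm_iota iota_scaleC flip: scaleC_of_real)

interpretation iota: bounded_linear \<iota> by (rule bounded_linear_iota)

lemma inj_iota: "inj \<iota>"
  by (rule linear_injective_0[OF iota.linear, THEN iffD2]) (metis norm_iota norm_eq_zero)

lemma closed_range_iota: "closed (range \<iota>)"
  using complete_isometric_image[OF zero_less_one subspace_UNIV bounded_linear_iota _ complete_UNIV]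
  by (simp add: norm_iota complete_imp_closed)

lemma range_iota_ideal: "\<iota> a * x \<in> range \<iota>" "x * \<iota> a \<in> range \<iota>"
  using ideal by (auto simp: algebra_ideal_def)

text \<open>Each \<open>x * \<iota> a\<close> lies in the ideal and is killed by
  \<open>range \<iota>\<close> from the left, so it is 0 by faithfulness. Annihilation on one side
  thus forces it on the other, and \<open>x\<close> induces the same multiplier as 0.\<close>

lemma annihilator_left:
  assumes "\<And>c. \<iota> c * x = 0" shows "x = 0"
proof -
  have "x * \<iota> a = 0" for a
  proof -
    obtain y where y: "x * \<iota> a = \<iota> y" using range_iota_ideal(2) by blast
    have "c * y = c * 0" for c
    proof (rule injD[OF inj_iota])
      have "\<iota> (c * y) = (\<iota> c * x) * \<iota> a" by (simp add: iota_mult y[symmetric] mult.assoc)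
      then show "\<iota> (c * y) = \<iota> (c * 0)" using assms by (simp add: iota.zero)
    qed
    then have "y = 0" by (rule faithful_left[OF faithful])
    then show ?thesis by (simp add: y iota.zero)
  qed
  then have "induced_multiplier \<iota> x = induced_multiplier \<iota> 0"
    using assms by (simp add: induced_multiplier_def)
  then show ?thesis using injective by (simp add: inj_eq)
qed

lemma annihilator_right:
  assumes "\<And>c. x * \<iota> c = 0" shows "x = 0"
proof -
  have "\<iota> a * x = 0" for a
  proof -
    obtain y where y: "\<iota> a * x = \<iota> y" using range_iota_ideal(1) by blast
    have "y * c = 0 * c" for c
    proof (rule injD[OF inj_iota])
      have "\<iota> (y * c) = \<iota> a * (x * \<iota> c)" by (simp add: iota_mult y[symmetric] mult.assoc)
      then show "\<iota> (y * c) = \<iota> (0 * c)" using assms by (simp add: iota.zero)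
    qed
    then have "y = 0" by (rule faithful_right[OF faithful])
    then show ?thesis by (simp add: y iota.zero)
  qed
  then have "induced_multiplier \<iota> x = induced_multiplier \<iota> 0"
    using assms by (simp add: induced_multiplier_def)
  then show ?thesis using injective by (simp add: inj_eq)
qed

section \<open>The predual of the ambient algebra as a bimodule\<close>

lemma pairing_left: "\<Psi> (x + y) p = \<Psi> x p + \<Psi> y p" "\<Psi> (scaleC c x) p = c * \<Psi> x p"
  and pairing_right: "\<Psi> x (p + q) = \<Psi> x p + \<Psi> x q" "\<Psi> x (scaleC c p) = c * \<Psi> x p"
  by (simp_all add: D.add_dual D.sc_dual D.predual_add D.predual_sc)

lemma pairing_diff: "\<Psi> x p - \<Psi> x q = \<Psi> x (p - q)"
  using pairing_right(1)[of x "p - q" q] by simp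

lemma pairing_le: "cmod (\<Psi> x p) \<le> norm x * norm p"
  using D.predual.dual_apply_le[OF D.dual_mem, of x p] by (simp add: D.isometric_dual)

lemma norm_le_if_pairing_le:
  assumes "0 \<le> K" "\<And>p. cmod (\<Psi> x p) \<le> K * norm p" shows "norm x \<le> K"
  using D.predual.dual_norm_le[OF assms(1), of "\<Psi> x"] assms(2) by (simp add: D.isometric_dual)

lemma pairing_eqI:
  assumes "\<And>p. \<Psi> x p = \<Psi> y p" shows "x = y"
  using assms D.bij_dual by (auto simp: bij_betw_def inj_on_def fun_eq_iff)

lemma pairing_surj:
  assumes "\<And>p q. f (p + q) = f p + f q" "\<And>c p. f (scaleC c p) = c * f p"
    "\<And>p. cmod (f p) \<le> K * norm p"
  shows "\<exists>x. \<forall>p. \<Psi> x p = f p"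
proof -
  have "f \<in> D.predual.dual" using assms by (auto simp: D.predual.dual_def)
  then show ?thesis using D.bij_dual unfolding bij_betw_def by force
qed

text \<open>In module notation \<open>lpre b p = p \<cdot> b\<close> and \<open>rpre b p = b \<cdot> p\<close>.\<close>

definition lpre :: "'b \<Rightarrow> 'p \<Rightarrow> 'p" where
  "lpre b p = (SOME q. \<forall>x. \<Psi> (b * x) p = \<Psi> x q)"

definition rpre :: "'b \<Rightarrow> 'p \<Rightarrow> 'p" where
  "rpre b p = (SOME q. \<forall>x. \<Psi> (x * b) p = \<Psi> x q)"

lemma pairing_lpre: "\<Psi> x (lpre b p) = \<Psi> (b * x) p"
proof -
  have "\<forall>x. \<Psi> (b * x) p = \<Psi> x (lpre b p)"
    unfolding lpre_def by (rule someI_ex) (use D.preadjoint_left[of b p] in blast)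
  then show ?thesis by simp
qed

lemma pairing_rpre: "\<Psi> x (rpre b p) = \<Psi> (x * b) p"
proof -
  have "\<forall>x. \<Psi> (x * b) p = \<Psi> x (rpre b p)"
    unfolding rpre_def by (rule someI_ex) (use D.preadjoint_right[of b p] in blast)
  then show ?thesis by simp
qed

text \<open>By Hahn-Banach, density follows once every bounded functional on \<open>'p\<close> that
  vanishes on \<open>S\<close> is zero; these functionals are the elements of
  \<open>'b\<close>.\<close>

lemma dense_if_separating:
  assumes sep: "\<And>x. (\<And>d. d \<in> S \<Longrightarrow> \<Psi> x d = 0) \<Longrightarrow> x = 0"
  shows "closure (scaleC.span S) = UNIV"
proof -
  have "p \<in> closure (scaleC.span S)" for p
  proof (rule mem_closure_if_annihilators[OF scaleC.subspace_span])
    fix f :: "'p \<Rightarrow> complex"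
    assume f: "f \<in> D.predual.dual" and 0: "\<And>x. x \<in> scaleC.span S \<Longrightarrow> f x = 0"
    then obtain x where x: "f = \<Psi> x" using D.bij_dual by (auto simp: bij_betw_def)
    have "x = 0" using 0[OF scaleC.span_base] by (intro sep) (simp flip: x)
    then show "f p = 0" using D.zero_dual by (simp add: x)
  qed
  then show ?thesis by blast
qed

lemma dense_lpre: "closure (scaleC.span {lpre (\<iota> c) p | c p. True}) = UNIV"
proof (rule dense_if_separating)
  fix x assume 0: "\<And>d. d \<in> {lpre (\<iota> c) p | c p. True} \<Longrightarrow> \<Psi> x d = 0"
  have "\<Psi> (\<iota> c * x) p = \<Psi> 0 p" for c p
    using 0[of "lpre (\<iota> c) p"] D.zero_dual by (auto simp: pairing_lpre)
  then show "x = 0" by (rule annihilator_left[OF pairing_eqI])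
qed

lemma dense_rpre: "closure (scaleC.span {rpre (\<iota> c) p | c p. True}) = UNIV"
proof (rule dense_if_separating)
  fix x assume 0: "\<And>d. d \<in> {rpre (\<iota> c) p | c p. True} \<Longrightarrow> \<Psi> x d = 0"
  have "\<Psi> (x * \<iota> c) p = \<Psi> 0 p" for c p
    using 0[of "rpre (\<iota> c) p"] D.zero_dual by (auto simp: pairing_rpre)
  then show "x = 0" by (rule annihilator_right[OF pairing_eqI])
qed

text \<open>The range of the isometry \<iota> is complete, hence closed, so its preimage under
  \<open>S\<close> is a closed subspace. It contains all products, whose span is dense.\<close>

lemma in_range_iota_if_products:
  fixes S :: "'a \<Rightarrow> 'b"
  assumes S: "bounded_linear S" "\<And>c a. S (scaleC c a) = scaleC c (S a)"
    and prod: "\<And>a b. S (a * b) \<in> range \<iota>"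
  shows "S a \<in> range \<iota>"
proof -
  interpret S: bounded_linear S by fact
  have range: "scaleC.subspace (range \<iota>)" using ideal by (simp add: algebra_ideal_def)
  have "scaleC.subspace (S -` range \<iota>)"
    by (rule scaleC.subspaceI)
      (auto simp only: vimage_eq S.zero S.add S(2) intro!: scaleC.subspace_0[OF range]
        scaleC.subspace_add[OF range] scaleC.subspace_scale[OF range])
  then have "scaleC.span {a * b | a b. True} \<subseteq> S -` range \<iota>"
    using prod by (intro scaleC.span_minimal) auto
  moreover have "closed (S -` range \<iota>)"
    using closed_range_iota
    by (intro continuous_closed_vimage) (simp_all add: S.isCont)
  ultimately have "closure (scaleC.span {a * b | a b. True}) \<subseteq> S -` range \<iota>"
    by (rule closure_minimal)
  then show ?thesis unfolding dense by blast
qed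

section \<open>Coefficient functionals on multipliers\<close>

interpretation M: complex_banach_algebra_on mult_scale "multipliers :: 'a map_pair set"
    mult_norm mult_times
  by (rule multipliers_complex_banach_algebra_on[OF faithful])

interpretation F: complex_banach_on "\<lambda>c f x. c * f x" M.functionals M.dual_norm
  by (rule M.complex_banach_on_functionals)

text \<open>The map \<open>h\<close> is kept general, because besides the two components of
  \<open>m\<close> it must also cover their composites with a fixed multiplier. The value 0 off
  \<open>multipliers\<close> is the convention of \<open>functionals\<close>.\<close>

definition coefficient :: "('a map_pair \<Rightarrow> 'b) \<Rightarrow> 'p \<Rightarrow> 'a map_pair \<Rightarrow> complex" where
  "coefficient h p = (\<lambda>m. if m \<in> multipliers then \<Psi> (h m) p else 0)"

definition lcoeff :: "'a \<Rightarrow> 'p \<Rightarrow> 'a map_pair \<Rightarrow> complex" where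
  "lcoeff a = coefficient (\<lambda>m. \<iota> (fst m a))"

definition rcoeff :: "'a \<Rightarrow> 'p \<Rightarrow> 'a map_pair \<Rightarrow> complex" where
  "rcoeff a = coefficient (\<lambda>m. \<iota> (snd m a))"

definition generators :: "('a map_pair \<Rightarrow> complex) set" where
  "generators = {lcoeff a p | a p. True} \<union> {rcoeff a p | a p. True}"

definition predual :: "('a map_pair \<Rightarrow> complex) set" where
  "predual = F.closure_on (F.span generators)"

text \<open>Bounded linearity on a carrier. The constant is explicit because sharp norm estimates of
  the generators depend on it.\<close>

definition bounded_map :: "real \<Rightarrow> ('a map_pair \<Rightarrow> 'b) \<Rightarrow> bool" where
  "bounded_map C h \<longleftrightarrow> 0 \<le> C \<and> (\<forall>m\<in>multipliers. \<forall>n\<in>multipliers. h (m + n) = h m + h n) \<and>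
     (\<forall>c. \<forall>m\<in>multipliers. h (mult_scale c m) = scaleC c (h m)) \<and>
     (\<forall>m\<in>multipliers. norm (h m) \<le> C * mult_norm m)"

lemma coefficient_right:
  "coefficient h (p + q) = coefficient h p + coefficient h q"
  "coefficient h (scaleC c p) = (\<lambda>m. c * coefficient h p m)"
  "coefficient h p - coefficient h q = coefficient h (p - q)"
  by (auto simp: coefficient_def pairing_right pairing_diff fun_eq_iff)

lemma coefficient_functional:
  assumes h: "bounded_map C h"
  shows "coefficient h p \<in> M.functionals" "M.dual_norm (coefficient h p) \<le> C * norm p"
proof -
  have le: "cmod (coefficient h p m) \<le> (C * norm p) * mult_norm m" if "m \<in> multipliers" for m
  proof -
    have "cmod (\<Psi> (h m) p) \<le> norm (h m) * norm p" by (rule pairing_le)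
    also have "\<dots> \<le> C * mult_norm m * norm p"
      using h that by (intro mult_right_mono) (auto simp: bounded_map_def)
    finally show ?thesis using that by (simp add: coefficient_def ac_simps)
  qed
  show "coefficient h p \<in> M.functionals"
    by (rule M.functionalsI[OF _ _ _ le])
      (use h M.subspace_add[OF M.subspace_carrier] M.subspace_scale[OF M.subspace_carrier] in
        \<open>simp_all add: coefficient_def bounded_map_def pairing_left\<close>)
  show "M.dual_norm (coefficient h p) \<le> C * norm p"
    using h le by (intro M.dual_norm_le) (auto simp: bounded_map_def)
qed

text \<open>With the sharp constant \<open>norm a\<close> a generator has norm at most
  \<open>norm a * norm p\<close>, which is what makes the generators norming without loss.\<close>

lemma bounded_map_fst_snd:
  "bounded_map (norm a) (\<lambda>m. \<iota> (fst m a))" "bounded_map (norm a) (\<lambda>m. \<iota> (snd m a))"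
  using mult_norm_ge[OF faithful]
  by (auto simp: bounded_map_def iota_add iota_scaleC norm_iota mult_scale_def mult.commute)

text \<open>These maps arise from translating a generator by a fixed multiplier on the side where
  the result is not visibly a generator. Only the existence of a bound matters for them.\<close>

lemma bounded_map_comp:
  assumes LR: "(L, R) \<in> multipliers"
  shows "\<exists>C. bounded_map C (\<lambda>m. \<iota> (L (fst m a)))" "\<exists>C. bounded_map C (\<lambda>m. \<iota> (R (snd m a)))"
proof -
  let ?C = "mult_norm (L, R) * norm a"
  note nonneg = mult_norm_nonneg[OF faithful LR]
  have "norm (L (L' a)) \<le> ?C * mult_norm (L', R')" "norm (R (R' a)) \<le> ?C * mult_norm (L', R')"
    if LR': "(L', R') \<in> multipliers" for L' R'
  proof -
    have "norm (L (L' a)) \<le> mult_norm (L, R) * norm (L' a)"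
      by (rule mult_norm_ge[OF faithful LR])
    also have "\<dots> \<le> mult_norm (L, R) * (mult_norm (L', R') * norm a)"
      by (intro mult_left_mono nonneg mult_norm_ge[OF faithful LR'])
    finally show "norm (L (L' a)) \<le> ?C * mult_norm (L', R')" by (simp add: ac_simps)
    have "norm (R (R' a)) \<le> mult_norm (L, R) * norm (R' a)"
      by (rule mult_norm_ge[OF faithful LR])
    also have "\<dots> \<le> mult_norm (L, R) * (mult_norm (L', R') * norm a)"
      by (intro mult_left_mono nonneg mult_norm_ge[OF faithful LR'])
    finally show "norm (R (R' a)) \<le> ?C * mult_norm (L', R')" by (simp add: ac_simps)
  qed
  then have "bounded_map ?C (\<lambda>m. \<iota> (L (fst m a)))" "bounded_map ?C (\<lambda>m. \<iota> (R (snd m a)))"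
    using nonneg
    by (auto simp: bounded_map_def iota_add iota_scaleC norm_iota mult_scale_def
        multiplier_add[OF faithful LR] multiplier_scaleC[OF faithful LR])
  then show "\<exists>C. bounded_map C (\<lambda>m. \<iota> (L (fst m a)))" "\<exists>C. bounded_map C (\<lambda>m. \<iota> (R (snd m a)))"
    by blast+
qed

lemma generators_functionals: "generators \<subseteq> M.functionals"
  unfolding generators_def lcoeff_def rcoeff_def
  using coefficient_functional(1) bounded_map_fst_snd by blast

lemma span_generators: "F.span generators \<subseteq> M.functionals"
  by (rule F.span_minimal[OF generators_functionals F.subspace_carrier])

lemma predual_subspace: "F.subspace predual"
  unfolding predual_def by (rule F.subspace_closure_on[OF F.subspace_span span_generators])

lemma generators_predual: "g \<in> generators \<Longrightarrow> g \<in> predual"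
  unfolding predual_def
  using F.closure_on_subset[OF span_generators] F.span_base by blast

lemma lcoeff_predual: "lcoeff a p \<in> predual" and rcoeff_predual: "rcoeff a p \<in> predual"
  by (rule generators_predual, unfold generators_def, blast)+

text \<open>For fixed \<open>h\<close> the coefficient depends linearly and boundedly on
  \<open>p\<close>, and \<open>predual\<close> is norm closed, so a set with dense span suffices as
  a test.\<close>

lemma coefficient_predual:
  assumes h: "bounded_map C h" and S: "closure (scaleC.span S) = UNIV"
    and gen: "\<And>d. d \<in> S \<Longrightarrow> coefficient h d \<in> predual"
  shows "coefficient h p \<in> predual"
proof -
  have C: "0 \<le> C" using h by (simp add: bounded_map_def)
  have "scaleC.subspace {p. coefficient h p \<in> predual}"
  proof (rule scaleC.subspaceI)
    have "coefficient h 0 = 0"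
      using pairing_diff[of _ 0 0] by (auto simp: coefficient_def fun_eq_iff)
    then show "0 \<in> {p. coefficient h p \<in> predual}"
      using F.subspace_0[OF predual_subspace] by (simp only: mem_Collect_eq)
  qed (use F.subspace_add[OF predual_subspace] F.subspace_scale[OF predual_subspace] in
      \<open>simp_all only: mem_Collect_eq coefficient_right\<close>)
  then have "scaleC.span S \<subseteq> {p. coefficient h p \<in> predual}"
    using gen by (intro scaleC.span_minimal) auto
  then have span: "coefficient h q \<in> predual" if "q \<in> scaleC.span S" for q using that by blast
  show ?thesis
    unfolding predual_def
  proof (rule F.closure_on_closed[OF span_generators])
    show "coefficient h p \<in> M.functionals" by (rule coefficient_functional[OF h])
    fix e :: real assume e: "e > 0"
    have "p \<in> closure (scaleC.span S)" "e / (C + 1) > 0" using S e C by simp_all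
    then obtain q where q: "q \<in> scaleC.span S" "dist q p < e / (C + 1)"
      unfolding closure_approachable by blast
    have "M.dual_norm (coefficient h p - coefficient h q) \<le> C * norm (p - q)"
      unfolding coefficient_right by (rule coefficient_functional[OF h])
    also have "\<dots> \<le> C * (e / (C + 1))"
      using q(2) C by (intro mult_left_mono) (auto simp: dist_norm norm_minus_commute)
    also have "\<dots> < e" using C e by (simp add: pos_divide_less_eq distrib_left)
    finally show "\<exists>g\<in>F.closure_on (F.span generators).
        M.dual_norm (coefficient h p - g) < e"
      using span[OF q(1)] unfolding predual_def by blast
  qed
qed

text \<open>Two of the four translates are generators again: those of \<open>lcoeff\<close> under
  right and of \<open>rcoeff\<close> under left multiplication by \<open>m\<close>. The other two
  are tested on the sets \<open>lpre (\<iota> c) q\<close> and \<open>rpre (\<iota> c) q\<close>,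
  which have dense span.\<close>

lemma generators_translate:
  assumes m: "m \<in> multipliers" and g: "g \<in> generators"
  shows "(\<lambda>n. if n \<in> multipliers then g (mult_times m n) else 0) \<in> predual" (is "?l \<in> _")
    and "(\<lambda>n. if n \<in> multipliers then g (mult_times n m) else 0) \<in> predual" (is "?r \<in> _")
proof -
  obtain L R where me: "m = (L, R)" by (cases m)
  have LR: "(L, R) \<in> multipliers" using m me by simp
  have mem: "mult_times m n \<in> multipliers" "mult_times n m \<in> multipliers" if "n \<in> multipliers" for n
    using m that by (simp_all add: M.mul_closed)
  consider a p where "g = lcoeff a p" | a p where "g = rcoeff a p"
    using g by (auto simp: generators_def)
  then have "?l \<in> predual \<and> ?r \<in> predual"
  proof cases
    case (1 a p)
    have l: "?l = coefficient (\<lambda>n. \<iota> (L (fst n a))) p"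
      using mem by (auto simp: 1 lcoeff_def coefficient_def me mult_times_def fun_eq_iff split_beta)
    have r: "?r = lcoeff (L a) p"
      using mem by (auto simp: 1 lcoeff_def coefficient_def me mult_times_def fun_eq_iff split_beta)
    obtain C where "bounded_map C (\<lambda>n. \<iota> (L (fst n a)))" using bounded_map_comp[OF LR] by blast
    then have "?l \<in> predual"
      unfolding l
    proof (rule coefficient_predual[OF _ dense_lpre])
      fix d assume "d \<in> {lpre (\<iota> c) q | c q. True}"
      then obtain c q where d: "d = lpre (\<iota> c) q" by blast
      have "\<Psi> (\<iota> (L (fst n a))) d = \<Psi> (\<iota> (fst n a)) (lpre (\<iota> (R c)) q)" for n :: "'a map_pair"
        by (simp add: d pairing_lpre multiplierD[OF LR] flip: iota_mult)
      then have "coefficient (\<lambda>n. \<iota> (L (fst n a))) d = lcoeff a (lpre (\<iota> (R c)) q)"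
        by (simp add: coefficient_def lcoeff_def cong: if_cong)
      then show "coefficient (\<lambda>n. \<iota> (L (fst n a))) d \<in> predual" by (simp add: lcoeff_predual)
    qed
    then show ?thesis by (simp add: r lcoeff_predual)
  next
    case (2 a p)
    have l: "?l = rcoeff (R a) p"
      using mem by (auto simp: 2 rcoeff_def coefficient_def me mult_times_def fun_eq_iff split_beta)
    have r: "?r = coefficient (\<lambda>n. \<iota> (R (snd n a))) p"
      using mem by (auto simp: 2 rcoeff_def coefficient_def me mult_times_def fun_eq_iff split_beta)
    obtain C where "bounded_map C (\<lambda>n. \<iota> (R (snd n a)))" using bounded_map_comp[OF LR] by blast
    then have "?r \<in> predual"
      unfolding r
    proof (rule coefficient_predual[OF _ dense_rpre])
      fix d assume "d \<in> {rpre (\<iota> c) q | c q. True}"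
      then obtain c q where d: "d = rpre (\<iota> c) q" by blast
      \<comment> \<open>The mirror image of the left-hand case:
        \<open>R (snd n a) * c = snd n a * L c\<close> moves the fixed multiplier away from
        \<open>n\<close> onto the element acting on \<open>q\<close>.\<close>
      have "\<Psi> (\<iota> (R (snd n a))) d = \<Psi> (\<iota> (snd n a)) (rpre (\<iota> (L c)) q)" for n :: "'a map_pair"
        by (simp add: d pairing_rpre multiplierD[OF LR] flip: iota_mult)
      then have "coefficient (\<lambda>n. \<iota> (R (snd n a))) d = rcoeff a (rpre (\<iota> (L c)) q)"
        by (simp add: coefficient_def rcoeff_def cong: if_cong)
      then show "coefficient (\<lambda>n. \<iota> (R (snd n a))) d \<in> predual" by (simp add: rcoeff_predual)
    qed
    then show ?thesis by (simp add: l rcoeff_predual)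
  qed
  then show "?l \<in> predual" "?r \<in> predual" by blast+
qed

lemma functional_represented:
  assumes \<phi>: "\<phi> \<in> complex_normed_on.dual (\<lambda>c f x. c * f x) predual M.dual_norm"
  shows "\<exists>m\<in>multipliers. \<forall>g\<in>generators. \<phi> g = g m"
proof -
  interpret P: complex_banach_on "\<lambda>c f x. c * f x" predual M.dual_norm
    unfolding predual_def by (rule F.complex_banach_on_closure_on[OF F.subspace_span span_generators])
  define K where "K = P.dual_norm \<phi>"
  have add: "\<phi> (f + g) = \<phi> f + \<phi> g" if "f \<in> predual" "g \<in> predual" for f g
    using \<phi> that by (simp add: P.dual_def)
  have scale: "\<phi> (\<lambda>m. c * f m) = c * \<phi> f" if "f \<in> predual" for f c
    using \<phi> that by (simp add: P.dual_def)
  have K: "0 \<le> K"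
    using \<phi> unfolding K_def P.dual_def by (blast intro: P.dual_norm_nonneg)
  have bound: "cmod (\<phi> (lcoeff a p)) \<le> K * norm a * norm p"
    "cmod (\<phi> (rcoeff a p)) \<le> K * norm a * norm p" for a p
  proof -
    have "cmod (\<phi> (lcoeff a p)) \<le> K * M.dual_norm (lcoeff a p)"
      unfolding K_def by (rule P.dual_apply_le[OF \<phi> lcoeff_predual])
    also have "\<dots> \<le> K * (norm a * norm p)"
      unfolding lcoeff_def using K bounded_map_fst_snd
      by (intro mult_left_mono coefficient_functional)
    finally show "cmod (\<phi> (lcoeff a p)) \<le> K * norm a * norm p" by (simp add: mult.assoc)
    have "cmod (\<phi> (rcoeff a p)) \<le> K * M.dual_norm (rcoeff a p)"
      unfolding K_def by (rule P.dual_apply_le[OF \<phi> rcoeff_predual])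
    also have "\<dots> \<le> K * (norm a * norm p)"
      unfolding rcoeff_def using K bounded_map_fst_snd
      by (intro mult_left_mono coefficient_functional)
    finally show "cmod (\<phi> (rcoeff a p)) \<le> K * norm a * norm p" by (simp add: mult.assoc)
  qed
  have right: "lcoeff a (p + q) = lcoeff a p + lcoeff a q"
    "lcoeff a (scaleC c p) = (\<lambda>m. c * lcoeff a p m)"
    "rcoeff a (p + q) = rcoeff a p + rcoeff a q"
    "rcoeff a (scaleC c p) = (\<lambda>m. c * rcoeff a p m)" for a p q c
    unfolding lcoeff_def rcoeff_def by (rule coefficient_right)+
  have left: "lcoeff (a + b) p = lcoeff a p + lcoeff b p"
    "lcoeff (scaleC c a) p = (\<lambda>m. c * lcoeff a p m)"
    "rcoeff (a + b) p = rcoeff a p + rcoeff b p"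
    "rcoeff (scaleC c a) p = (\<lambda>m. c * rcoeff a p m)" for a b p c
    \<comment> \<open>Linearity in \<open>a\<close> rests on the automatic linearity of both
      components of a multiplier.\<close>
    using multiplier_add[OF faithful, of "fst m" "snd m" for m]
      multiplier_scaleC[OF faithful, of "fst m" "snd m" for m]
    by (auto simp: lcoeff_def rcoeff_def coefficient_def fun_eq_iff iota_add iota_scaleC pairing_left
        simp del: split_paired_All)
  \<comment> \<open>For fixed \<open>a\<close> the right-hand side is a bounded functional of
    \<open>p\<close>, hence an element of \<open>'b\<close>. On the generators, \<phi> is thus
    encoded by two maps from \<open>'a\<close> to \<open>'b\<close>.\<close>
  have "\<exists>x. \<forall>p. \<Psi> x p = \<phi> (lcoeff a p)" for a
    by (rule pairing_surj[OF _ _ bound(1)]) (simp_all only: right add scale lcoeff_predual)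
  then obtain S where S: "\<And>a p. \<Psi> (S a) p = \<phi> (lcoeff a p)" by metis
  have "\<exists>x. \<forall>p. \<Psi> x p = \<phi> (rcoeff a p)" for a
    by (rule pairing_surj[OF _ _ bound(2)]) (simp_all only: right add scale rcoeff_predual)
  then obtain T where T: "\<And>a p. \<Psi> (T a) p = \<phi> (rcoeff a p)" by metis
  have S_scaleC: "S (scaleC c a) = scaleC c (S a)" for c a
    by (rule pairing_eqI) (simp only: S pairing_left left scale lcoeff_predual)
  have T_scaleC: "T (scaleC c a) = scaleC c (T a)" for c a
    by (rule pairing_eqI) (simp only: T pairing_left left scale rcoeff_predual)
  have S_linear: "bounded_linear S"
  proof (rule bounded_linear_intro)
    show "S (a + b) = S a + S b" for a b
      by (rule pairing_eqI) (simp only: S pairing_left left add lcoeff_predual)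
    show "S (r *\<^sub>R a) = r *\<^sub>R S a" for r a using S_scaleC[of "of_real r" a] by (simp add: scaleC_of_real)
    show "norm (S a) \<le> norm a * K" for a
      using norm_le_if_pairing_le[of "K * norm a" "S a"] K bound by (simp add: S mult.commute)
  qed
  have T_linear: "bounded_linear T"
  proof (rule bounded_linear_intro)
    show "T (a + b) = T a + T b" for a b
      by (rule pairing_eqI) (simp only: T pairing_left left add rcoeff_predual)
    show "T (r *\<^sub>R a) = r *\<^sub>R T a" for r a using T_scaleC[of "of_real r" a] by (simp add: scaleC_of_real)
    show "norm (T a) \<le> norm a * K" for a
      using norm_le_if_pairing_le[of "K * norm a" "T a"] K bound by (simp add: T mult.commute)
  qed
  have ST: "\<iota> c * S a = T c * \<iota> a" for a c
  proof (rule pairing_eqI)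
    fix p
    \<comment> \<open>At a multiplier \<open>(L, R)\<close> the two sides pair \<open>p\<close> with
      \<open>\<iota> c * \<iota> (L a)\<close> and with \<open>\<iota> (R c) * \<iota> a\<close>.
      One functional with two descriptions ties \<open>S\<close> to \<open>T\<close>.\<close>
    have eq: "lcoeff a (lpre (\<iota> c) p) = rcoeff c (rpre (\<iota> a) p)"
      by (auto simp: lcoeff_def rcoeff_def coefficient_def fun_eq_iff pairing_lpre pairing_rpre
          multiplierD simp flip: iota_mult)
    show "\<Psi> (\<iota> c * S a) p = \<Psi> (T c * \<iota> a) p"
      by (simp only: S T eq flip: pairing_lpre[of _ "\<iota> c"] pairing_rpre[of _ "\<iota> a"])
  qed
  have "S (a * b) \<in> range \<iota>" for a b
  proof -
    \<comment> \<open>Multiplied by \<open>\<iota> c\<close>, both terms become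
      \<open>T c * \<iota> a * \<iota> b\<close>, so the difference is annihilated by the
      ideal.\<close>
    have "\<iota> c * (S (a * b) - S a * \<iota> b) = 0" for c
    proof -
      have "\<iota> c * S (a * b) = (T c * \<iota> a) * \<iota> b" by (simp add: ST iota_mult mult.assoc)
      also have "\<dots> = \<iota> c * (S a * \<iota> b)" by (simp only: ST[symmetric] mult.assoc)
      finally show ?thesis by (simp add: right_diff_distrib)
    qed
    then have "S (a * b) - S a * \<iota> b = 0" by (rule annihilator_left)
    then show ?thesis using range_iota_ideal(2)[of "S a" b] by simp
  qed
  then have S_range: "S a \<in> range \<iota>" for a by (rule in_range_iota_if_products[OF S_linear S_scaleC])
  have "T (a * b) \<in> range \<iota>" for a b
  proof -
    have "(T (a * b) - \<iota> a * T b) * \<iota> c = 0" for c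
    proof -
      have "T (a * b) * \<iota> c = \<iota> a * (\<iota> b * S c)" by (simp add: ST[symmetric] iota_mult mult.assoc)
      also have "\<dots> = \<iota> a * T b * \<iota> c" by (simp only: ST mult.assoc)
      finally show ?thesis by (simp add: left_diff_distrib)
    qed
    then have "T (a * b) - \<iota> a * T b = 0" by (rule annihilator_right)
    then show ?thesis using range_iota_ideal(1)[of a "T b"] by simp
  qed
  then have T_range: "T a \<in> range \<iota>" for a by (rule in_range_iota_if_products[OF T_linear T_scaleC])
  obtain L R where L: "\<And>a. S a = \<iota> (L a)" and R: "\<And>a. T a = \<iota> (R a)"
    using S_range T_range unfolding image_iff by metis
  have LR: "(L, R) \<in> multipliers"
    using ST by (auto simp: multipliers_def L R simp flip: iota_mult intro: injD[OF inj_iota])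
  have "\<phi> (lcoeff a p) = lcoeff a p (L, R)" "\<phi> (rcoeff a p) = rcoeff a p (L, R)" for a p
    unfolding S[symmetric] T[symmetric] L R by (simp_all add: lcoeff_def rcoeff_def coefficient_def LR)
  then have "\<phi> g = g (L, R)" if "g \<in> generators" for g
    using that unfolding generators_def by blast
  then show ?thesis using LR by blast
qed

text \<open>What remains is the norming property. Bounds on all coefficients of \<open>m\<close>
  turn, by the isometric duality of \<open>'b\<close> and the isometry of \<iota>, into the bound
  \<open>K\<close> for both components, and hence for the maximum of their operator norms.\<close>

lemma multipliers_dual_banach_algebra:
  "dual_banach_algebra mult_scale (multipliers :: 'a map_pair set) mult_norm mult_times
     (\<lambda>c f x. c * f x) predual M.dual_norm (\<lambda>m. \<lambda>f\<in>predual. f m)"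
  unfolding predual_def
proof (rule M.dual_banach_algebra_if_generators[OF generators_functionals])
  fix m :: "'a map_pair" and K :: real
  assume m: "m \<in> multipliers" and K: "0 \<le> K"
    and le: "\<And>g. g \<in> generators \<Longrightarrow> cmod (g m) \<le> K * M.dual_norm g"
  obtain L R where me: "m = (L, R)" by (cases m)
  have "norm (\<iota> (L a)) \<le> K * norm a" "norm (\<iota> (R a)) \<le> K * norm a" for a
  proof -
    show "norm (\<iota> (L a)) \<le> K * norm a"
    proof (rule norm_le_if_pairing_le)
      fix p
      have "cmod (lcoeff a p m) \<le> K * M.dual_norm (lcoeff a p)"
        by (rule le) (auto simp: generators_def)
      also have "\<dots> \<le> K * (norm a * norm p)"
        unfolding lcoeff_def using K bounded_map_fst_snd
        by (intro mult_left_mono coefficient_functional)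
      finally show "cmod (\<Psi> (\<iota> (L a)) p) \<le> K * norm a * norm p"
        using m by (simp add: lcoeff_def coefficient_def me mult.assoc)
    qed (simp add: K)
    show "norm (\<iota> (R a)) \<le> K * norm a"
    proof (rule norm_le_if_pairing_le)
      fix p
      have "cmod (rcoeff a p m) \<le> K * M.dual_norm (rcoeff a p)"
        by (rule le) (auto simp: generators_def)
      also have "\<dots> \<le> K * (norm a * norm p)"
        unfolding rcoeff_def using K bounded_map_fst_snd
        by (intro mult_left_mono coefficient_functional)
      finally show "cmod (\<Psi> (\<iota> (R a)) p) \<le> K * norm a * norm p"
        using m by (simp add: rcoeff_def coefficient_def me mult.assoc)
    qed (simp add: K)
  qed
  then show "mult_norm m \<le> K" unfolding me using K by (intro mult_norm_le) (simp_all add: norm_iota)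
qed (fold predual_def, fact functional_represented, fact generators_translate, fact generators_translate)

end

theorem theorem7p1:
  fixes \<iota> :: "'a::complex_banach_algebra \<Rightarrow> 'b::complex_banach_algebra"
    and \<Psi> :: "'b \<Rightarrow> 'p::complex_banach_space \<Rightarrow> complex"
  assumes faithful: "faithful_algebra TYPE('a)"
    and dense: "closure (module.span scaleC {a * b | a b :: 'a. True}) = UNIV"
    and dual: "dual_banach_algebra scaleC (UNIV :: 'b set) norm (*)
                 scaleC (UNIV :: 'p set) norm \<Psi>"
    and hom: "isometric_hom \<iota>"
    and essential: "essential_ideal (range \<iota>)"
    and injective: "inj (induced_multiplier \<iota>)"
  shows "\<exists>(scE :: complex \<Rightarrow> ('a map_pair \<Rightarrow> complex) \<Rightarrow> ('a map_pair \<Rightarrow> complex)) E nrmE \<Phi>.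
           dual_banach_algebra mult_scale (multipliers :: 'a map_pair set) mult_norm mult_times
             scE E nrmE \<Phi>"
proof -
  have ideal: "algebra_ideal (range \<iota>)" using essential by (simp add: essential_ideal_def)
  interpret dual_algebra_embedding \<iota> \<Psi>
    by (rule dual_algebra_embedding.intro[OF faithful dense dual hom ideal injective])
  show ?thesis using multipliers_dual_banach_algebra by blast
qed

end
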